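(* Let $\mathscr{F}$ be a codimension one $\mathscr{L}$-foliation on $\mathbf{C}\mathbf{P}(n)$. If all elements of $\mathscr{L}$ are nilpotent, then $\mathscr{F}$ has a (non-constant) rational first integral.
   Context: A codimension one foliation $\mathscr{F}$ on $\mathbf{C}\mathbf{P}(n)$ is given in homogeneous coordinates by a $1$-form $\omega=\sum_{k=0}^nA_kdz_k$ on $\mathbf{C}^{n+1}$, with $A_k$ homogeneous polynomials of the same degree, $\omega\wedge d\omega=0$, $\sum z_kA_k=0$, and $\{A_0=\dots=A_n=0\}$ of codimension $\geq2$. Let $\chi(\mathbf{C}\mathbf{P}(n))$ be the Lie algebra of holomorphic vector fields on $\mathbf{C}\mathbf{P}(n)$; it is identified with $(n+1)\times(n+1)$ complex matrices (linear vector fields on $\mathbf{C}^{n+1}$) modulo $\mathbf{C}\cdot\mathrm{Id}$ (the radial field), and an element is called nilpotent if it is induced by a nilpotent matrix. $\mathscr{F}$ is an $\mathscr{L}$-foliation if there is a Lie subalgebra $\mathscr{L}\subset\chi(\mathbf{C}\mathbf{P}(n))$ such that, for generic $z$, $\mathscr{L}(z)=\{X(z):X\in\mathscr{L}\}$ is the tangent space at $z$ to the leaf of $\mathscr{F}$ (so it has dimension $n-1$); $\mathscr{L}$ always denotes the maximal such subalgebra, i.e. the algebra of all holomorphic vector fields on $\mathbf{C}\mathbf{P}(n)$ tangent to $\mathscr{F}$. *)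

theory Defs
  imports "HOL-Analysis.Analysis" "HOL-Library.Extended_Nat"
begin

(* Points of CP(n) are given by homogeneous coordinates in C^(n+1), which is the type
   complex^'n with CARD('n) = n + 1. *)

section \<open>Polynomials and algebraic sets\<close>

definition poly_fun :: "(complex^'n \<Rightarrow> complex) \<Rightarrow> bool" where
  "poly_fun p \<longleftrightarrow> (\<exists>d (c :: ('n \<Rightarrow> nat) \<Rightarrow> complex).
     p = (\<lambda>z. \<Sum>a | sum a UNIV \<le> d. c a * (\<Prod>i\<in>UNIV. (z $ i) ^ a i)))"

definition homogeneous_poly :: "nat \<Rightarrow> (complex^'n \<Rightarrow> complex) \<Rightarrow> bool" where
  "homogeneous_poly d p \<longleftrightarrow> (\<exists>c :: ('n \<Rightarrow> nat) \<Rightarrow> complex.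
     p = (\<lambda>z. \<Sum>a | sum a UNIV = d. c a * (\<Prod>i\<in>UNIV. (z $ i) ^ a i)))"

definition algebraic_set :: "(complex^'n) set \<Rightarrow> bool" where
  "algebraic_set Z \<longleftrightarrow> (\<exists>S. (\<forall>p\<in>S. poly_fun p) \<and> Z = {z. \<forall>p\<in>S. p z = 0})"

definition irreducible_algebraic_set :: "(complex^'n) set \<Rightarrow> bool" where
  "irreducible_algebraic_set Y \<longleftrightarrow> algebraic_set Y \<and> Y \<noteq> {} \<and>
     (\<forall>Y1 Y2. algebraic_set Y1 \<and> algebraic_set Y2 \<and> Y = Y1 \<union> Y2 \<longrightarrow> Y = Y1 \<or> Y = Y2)"

(* Krull codimension in the affine space: the length of the longest chain of irreducible
   algebraic sets ascending from Y, minimised over the irreducible Y contained in Z. *)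

definition irreducible_codim :: "(complex^'n) set \<Rightarrow> enat" where
  "irreducible_codim Y = Sup {enat k | k. \<exists>C :: nat \<Rightarrow> (complex^'n) set.
     C 0 = Y \<and> (\<forall>i\<le>k. irreducible_algebraic_set (C i)) \<and> (\<forall>i<k. C i \<subset> C (Suc i))}"

definition alg_codim :: "(complex^'n) set \<Rightarrow> enat" where
  "alg_codim Z = (INF Y\<in>{Y. irreducible_algebraic_set Y \<and> Y \<subseteq> Z}. irreducible_codim Y)"

(* Generic means: outside a proper Zariski closed subset. It is only used for properties
   invariant under scaling of z, so it amounts to genericity on CP(n). *)

definition generically :: "(complex^'n \<Rightarrow> bool) \<Rightarrow> bool" where
  "generically P \<longleftrightarrow> (\<exists>Z. algebraic_set Z \<and> Z \<noteq> UNIV \<and> (\<forall>z. z \<notin> Z \<longrightarrow> P z))"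


section \<open>Differential forms on the space of homogeneous coordinates\<close>

(* The 1-form \<Sum> A_k dz_k is the function z \<mapsto> (A_k(z))_k; a 2-form at a point is its
   antisymmetric matrix of values on pairs of coordinate vectors. *)

definition partial_deriv :: "'n \<Rightarrow> (complex^'n \<Rightarrow> complex) \<Rightarrow> complex^'n \<Rightarrow> complex" where
  "partial_deriv k f z = deriv (\<lambda>t. f (z + t *s axis k 1)) 0"

definition differential :: "(complex^'n \<Rightarrow> complex) \<Rightarrow> complex^'n \<Rightarrow> complex^'n" where
  "differential f z = (\<chi> k. partial_deriv k f z)"

definition ext_deriv :: "(complex^'n \<Rightarrow> complex^'n) \<Rightarrow> complex^'n \<Rightarrow> 'n \<Rightarrow> 'n \<Rightarrow> complex" where
  "ext_deriv A z i j = partial_deriv i (\<lambda>w. A w $ j) z - partial_deriv j (\<lambda>w. A w $ i) z"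

definition wedge11 :: "complex^'n \<Rightarrow> complex^'n \<Rightarrow> 'n \<Rightarrow> 'n \<Rightarrow> complex" where
  "wedge11 \<alpha> \<beta> i j = \<alpha> $ i * \<beta> $ j - \<alpha> $ j * \<beta> $ i"

definition wedge12 :: "complex^'n \<Rightarrow> ('n \<Rightarrow> 'n \<Rightarrow> complex) \<Rightarrow> 'n \<Rightarrow> 'n \<Rightarrow> 'n \<Rightarrow> complex" where
  "wedge12 \<alpha> \<beta> i j k = \<alpha> $ i * \<beta> j k + \<alpha> $ j * \<beta> k i + \<alpha> $ k * \<beta> i j"

definition eval_form :: "complex^'n \<Rightarrow> complex^'n \<Rightarrow> complex" where
  "eval_form \<alpha> v = (\<Sum>k\<in>UNIV. \<alpha> $ k * v $ k)"

definition codim1_foliation :: "(complex^'n \<Rightarrow> complex^'n) \<Rightarrow> bool" where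
  "codim1_foliation A \<longleftrightarrow>
     (\<exists>d. \<forall>k. homogeneous_poly d (\<lambda>z. A z $ k)) \<and>
     (\<forall>z i j k. wedge12 (A z) (ext_deriv A z) i j k = 0) \<and>
     (\<forall>z. (\<Sum>k\<in>UNIV. z $ k * A z $ k) = 0) \<and>
     alg_codim {z. \<forall>k. A z $ k = 0} \<ge> 2"

(* Preimage in C^(n+1) of the tangent space to the leaf through [z], if A z \<noteq> 0. *)

definition leaf_tangent :: "(complex^'n \<Rightarrow> complex^'n) \<Rightarrow> complex^'n \<Rightarrow> (complex^'n) set" where
  "leaf_tangent A z = {v. eval_form (A z) v = 0}"


section \<open>Holomorphic vector fields on projective space\<close>

quotient_type (overloaded) 'n cp_field = "complex^'n^'n" / "\<lambda>A B. \<exists>c. A - B = mat c"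
  morphisms rep_cp_field cp_field_of_matrix
proof (rule equivpI)
  show "reflp (\<lambda>A B :: complex^'n^'n. \<exists>c. A - B = mat c)"
    by (rule reflpI) (auto simp: mat_def vec_eq_iff intro!: exI[of _ 0])
  show "symp (\<lambda>A B :: complex^'n^'n. \<exists>c. A - B = mat c)"
  proof (rule sympI)
    fix A B :: "complex^'n^'n" assume "\<exists>c. A - B = mat c"
    then obtain c where "A - B = mat c" by blast
    then have "B - A = - mat c" by (metis minus_diff_eq)
    also have "- mat c = mat (- c)" by (simp add: mat_def vec_eq_iff)
    finally show "\<exists>c. B - A = mat c" by blast
  qed
  show "transp (\<lambda>A B :: complex^'n^'n. \<exists>c. A - B = mat c)"
  proof (rule transpI)
    fix A B C :: "complex^'n^'n" assume "\<exists>c. A - B = mat c" "\<exists>c. B - C = mat c"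
    then obtain c c' where "A - B = mat c" "B - C = mat c'" by blast
    then have "A - C = mat c + mat c'" by (metis add_diff_eq diff_add_cancel)
    also have "\<dots> = mat (c + c')" by (simp add: mat_def vec_eq_iff)
    finally show "\<exists>c. A - C = mat c" by blast
  qed
qed

lift_definition cp_zero :: "('n::finite) cp_field" is "0 :: complex^'n^'n" .

lift_definition cp_add :: "('n::finite) cp_field \<Rightarrow> 'n cp_field \<Rightarrow> 'n cp_field"
  is "\<lambda>A B :: complex^'n^'n. A + B"
proof -
  fix A A' B B' :: "complex^'n^'n" assume "\<exists>c. A - A' = mat c" "\<exists>c. B - B' = mat c"
  then obtain c c' where "A - A' = mat c" "B - B' = mat c'" by blast
  then have "A + B - (A' + B') = mat c + mat c'" by (metis add_diff_add)
  also have "\<dots> = mat (c + c')" by (simp add: mat_def vec_eq_iff)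
  finally show "\<exists>c. A + B - (A' + B') = mat c" by blast
qed

lift_definition cp_scale :: "complex \<Rightarrow> ('n::finite) cp_field \<Rightarrow> 'n cp_field"
  is "\<lambda>c (A :: complex^'n^'n). \<chi> i j. c * A $ i $ j"
proof -
  fix c :: complex and A B :: "complex^'n^'n" assume "\<exists>d. A - B = mat d"
  then obtain d where "A - B = mat d" by blast
  then have "A = B + mat d" by (metis add.commute diff_add_cancel)
  then have "(\<chi> i j. c * A $ i $ j) - (\<chi> i j. c * B $ i $ j) = mat (c * d)"
    by (simp add: mat_def vec_eq_iff algebra_simps)
  then show "\<exists>d. (\<chi> i j. c * A $ i $ j) - (\<chi> i j. c * B $ i $ j) = mat d" by blast
qed

(* The commutator of matrices is the Lie bracket of the linear vector fields up to sign. *)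

lift_definition cp_bracket :: "('n::finite) cp_field \<Rightarrow> 'n cp_field \<Rightarrow> 'n cp_field"
  is "\<lambda>A B :: complex^'n^'n. A ** B - B ** A"
proof -
  fix A A' B B' :: "complex^'n^'n" assume "\<exists>c. A - A' = mat c" "\<exists>c. B - B' = mat c"
  then obtain c c' where "A - A' = mat c" "B - B' = mat c'" by blast
  then have A: "A = A' + mat c" and B: "B = B' + mat c'" by (metis add.commute diff_add_cancel)+
  have comm: "mat d ** M = M ** mat d" for d and M :: "complex^'n^'n"
    by (auto simp: mat_def matrix_matrix_mult_def vec_eq_iff if_distrib if_distribR sum.delta
        sum.delta' mult.commute cong: if_cong)
  have rdistrib: "(M + N) ** K = M ** K + N ** K" for M N K :: "complex^'n^'n"
    by (simp add: matrix_matrix_mult_def vec_eq_iff sum.distrib distrib_right)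
  have "A ** B - B ** A = A' ** B' - B' ** A'"
    unfolding A B matrix_add_ldistrib rdistrib
    by (simp add: comm[of c B'] comm[of c' A'] comm[of c "mat c'"])
  then have "A ** B - B ** A - (A' ** B' - B' ** A') = mat 0"
    by (simp add: mat_def vec_eq_iff)
  then show "\<exists>c. A ** B - B ** A - (A' ** B' - B' ** A') = mat c" by blast
qed

definition lie_subalgebra :: "('n::finite) cp_field set \<Rightarrow> bool" where
  "lie_subalgebra L \<longleftrightarrow> cp_zero \<in> L \<and> (\<forall>X\<in>L. \<forall>Y\<in>L. cp_add X Y \<in> L) \<and>
     (\<forall>c. \<forall>X\<in>L. cp_scale c X \<in> L) \<and> (\<forall>X\<in>L. \<forall>Y\<in>L. cp_bracket X Y \<in> L)"

definition nilpotent_matrix :: "complex^'n^'n \<Rightarrow> bool" where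
  "nilpotent_matrix B \<longleftrightarrow> (\<exists>m. ((\<lambda>M. B ** M) ^^ m) (mat 1) = 0)"

definition nilpotent_field :: "('n::finite) cp_field \<Rightarrow> bool" where
  "nilpotent_field X \<longleftrightarrow> (\<exists>B. X = cp_field_of_matrix B \<and> nilpotent_matrix B)"

(* The tangent space to CP(n) at [z] is C^(n+1) / C z. The value of the field induced by B is
   the coset B z + C z, which is what the different matrices inducing the field yield. *)

definition field_at :: "('n::finite) cp_field \<Rightarrow> complex^'n \<Rightarrow> (complex^'n) set" where
  "field_at X z = {B *v z | B. cp_field_of_matrix B = X}"


section \<open>L-foliations\<close>

definition L_foliation :: "(complex^'n \<Rightarrow> complex^'n) \<Rightarrow> bool" where
  "L_foliation A \<longleftrightarrow> codim1_foliation A \<and>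
     (\<exists>L. lie_subalgebra L \<and> generically (\<lambda>z. (\<Union>X\<in>L. field_at X z) = leaf_tangent A z))"

definition tangent_algebra :: "(complex^'n \<Rightarrow> complex^'n) \<Rightarrow> 'n cp_field set" where
  "tangent_algebra A = {X. \<forall>z. A z \<noteq> 0 \<longrightarrow> field_at X z \<subseteq> leaf_tangent A z}"

(* The rational function P / Q on CP(n), with df \<and> \<omega> = 0 wherever it is defined. *)

definition nonconst_rational_first_integral ::
    "(complex^'n \<Rightarrow> complex^'n) \<Rightarrow> (complex^'n \<Rightarrow> complex) \<Rightarrow> (complex^'n \<Rightarrow> complex) \<Rightarrow> bool" where
  "nonconst_rational_first_integral A P Q \<longleftrightarrow>
     (\<exists>d. homogeneous_poly d P \<and> homogeneous_poly d Q) \<and>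
     (\<exists>z. Q z \<noteq> 0) \<and>
     (\<nexists>c. \<forall>z. Q z \<noteq> 0 \<longrightarrow> P z / Q z = c) \<and>
     (\<forall>z. Q z \<noteq> 0 \<longrightarrow> (\<forall>i j. wedge11 (differential (\<lambda>w. P w / Q w) z) (A z) i j = 0))"

end

theory Submission
  imports Defs "HOL-Library.Function_Algebras"
begin

text \<open>
  Why the theorem holds. The traceless matrices whose fields lie in a subalgebra
  \<open>L\<close> spanning the leaves form a Lie algebra \<open>H\<close> of nilpotent matrices. A polynomial
  \<open>P\<close> homogeneous of degree \<open>d\<close> that is killed by \<open>H\<close> is constant along the orbits of \<open>H\<close>, and for
  two such polynomials \<open>P\<close>, \<open>Q\<close> of the same degree the covector \<open>Q dP - P dQ\<close> also kills the radial
  field. At a generic point it therefore kills the whole kernel of \<open>\<omega>\<close>, so it is proportional to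
  \<open>\<omega>\<close>, and \<open>P / Q\<close> is a first integral. What has to be found are two linearly independent
  invariants of the same degree.

  They are found by counting dimensions. By the argument of Engel's theorem (\<open>engel_adjoint\<close>),
  \<open>H\<close> has a chain of subalgebras, each an ideal of codimension one in the next
  (\<open>subnormal_chain_exists\<close>). Start with the homogeneous polynomials of degree \<open>d\<close> in \<open>N\<close>
  variables, a space of dimension about \<open>d ^ (N - 1)\<close>, and impose the elements \<open>x\<close> of the chain
  one after another.
  Each \<open>x\<close> acts on the invariants of its predecessors, and does so nilpotently, of order
  \<open>O(d)\<close>; hence passing to its kernel divides the dimension by at most \<open>O(d)\<close>
  (\<open>nilpotent_kernel_bound\<close>). Steps at which \<open>x\<close> acts as zero cost nothing. The other steps
  number at most \<open>N - 2\<close> (\<open>effective_steps_bound\<close>): at a generic point \<open>z\<close> their vectors \<open>x z\<close>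
  are linearly independent, by triangularity against the polynomials that witness that \<open>x\<close> acts
  nontrivially; moreover \<open>z\<close> itself is independent of them, because the same count in degree one
  gives an invariant linear form; and all these vectors lie in the \<open>(N - 1)\<close>-dimensional kernel of
  \<open>\<omega>\<close>. So the invariants of degree \<open>d\<close> have dimension at least a constant times \<open>d\<close>, which
  exceeds one for large \<open>d\<close> (\<open>two_invariants_exist\<close>).
\<close>

section \<open>Nilpotent operators\<close>

text \<open>
  If \<open>D ^ k = 0\<close> on \<open>W\<close>, then \<open>dim W \<le> k * dim (ker D)\<close>: the power \<open>D ^ j\<close> embeds
  \<open>ker D ^ (j + 1) / ker D ^ j\<close> into \<open>ker D\<close>. The bound is phrased by spanning sets, and linearity
  is demanded on \<open>W\<close> only, because differentiation is linear just on differentiable functions.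
\<close>
lemma (in vector_space) nilpotent_kernel_bound:
  assumes W: "subspace W"
    and add: "\<And>x y. x \<in> W \<Longrightarrow> y \<in> W \<Longrightarrow> D (x + y) = D x + D y"
    and hom: "\<And>c x. x \<in> W \<Longrightarrow> D (scale c x) = scale c (D x)"
    and inv: "\<And>x. x \<in> W \<Longrightarrow> D x \<in> W"
    and nil: "\<And>x. x \<in> W \<Longrightarrow> (D ^^ k) x = 0"
    and B: "finite B" "{x \<in> W. D x = 0} \<subseteq> span B"
  shows "\<exists>C. finite C \<and> card C \<le> k * card B \<and> W \<subseteq> span C"
proof -
  have invj: "(D ^^ j) x \<in> W" if "x \<in> W" for j x
    using that by (induction j) (auto intro: inv)
  have addj: "(D ^^ j) (x + y) = (D ^^ j) x + (D ^^ j) y" if "x \<in> W" "y \<in> W" for j x y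
    using that by (induction j) (auto simp: add invj)
  have homj: "(D ^^ j) (scale c x) = scale c ((D ^^ j) x)" if "x \<in> W" for j c x
    using that by (induction j) (auto simp: hom invj)
  have zeroj: "(D ^^ j) 0 = 0" for j
    using homj[of 0 j 0] W by (simp add: subspace_0)
  have sumj: "(D ^^ j) (\<Sum>x\<in>T. scale (a x) (f x)) = (\<Sum>x\<in>T. scale (a x) ((D ^^ j) (f x)))"
    if "finite T" "\<And>x. x \<in> T \<Longrightarrow> f x \<in> W" for j T a and f :: "'b \<Rightarrow> 'b"
    using that
  proof (induction T rule: finite_induct)
    case empty
    then show ?case by (simp add: zeroj)
  next
    case (insert t T)
    have "(\<Sum>x\<in>T. scale (a x) (f x)) \<in> W"
      using insert.prems by (intro subspace_sum subspace_scale W) auto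
    then show ?case
      using insert by (simp add: addj homj subspace_scale W)
  qed
  have "\<exists>C. finite C \<and> card C \<le> j * card B \<and> {x \<in> W. (D ^^ j) x = 0} \<subseteq> span C" for j
  proof (induction j)
    case 0
    show ?case by (rule exI[of _ "{}"]) auto
  next
    case (Suc j)
    then obtain C where C: "finite C" "card C \<le> j * card B" "{x \<in> W. (D ^^ j) x = 0} \<subseteq> span C"
      by blast
    define V where "V = (D ^^ j) ` {x \<in> W. (D ^^ Suc j) x = 0}"
    obtain E where E: "E \<subseteq> V" "independent E" "V \<subseteq> span E"
      using maximal_independent_subset by blast
    have "V \<subseteq> {x \<in> W. D x = 0}"
      by (auto simp: V_def invj)
    then have "E \<subseteq> span B" using E B by blast
    then have finE: "finite E" and cardE: "card E \<le> card B"
      using independent_span_bound[OF B(1) E(2)] by auto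
    have "\<exists>f. \<forall>e\<in>E. f e \<in> W \<and> (D ^^ j) (f e) = e"
      using E(1) by (intro bchoice) (auto simp: V_def)
    then obtain f where f: "\<And>e. e \<in> E \<Longrightarrow> f e \<in> W" "\<And>e. e \<in> E \<Longrightarrow> (D ^^ j) (f e) = e" by blast
    have "x \<in> span (C \<union> f ` E)" if x: "x \<in> W" "(D ^^ Suc j) x = 0" for x
    proof -
      have "(D ^^ j) x \<in> span E" using E(3) x unfolding V_def by blast
      then obtain a where a: "(D ^^ j) x = (\<Sum>e\<in>E. scale (a e) e)"
        unfolding span_finite[OF finE] by blast
      define y where "y = (\<Sum>e\<in>E. scale (a e) (f e))"
      have yW: "y \<in> W" unfolding y_def by (intro subspace_sum subspace_scale W f)
      have "(D ^^ j) y = (D ^^ j) x"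
        unfolding y_def a using finE f by (subst sumj) auto
      moreover have "(D ^^ j) (x - y) = (D ^^ j) x - (D ^^ j) y"
        using addj[OF x(1) subspace_neg[OF W yW], of j] homj[OF yW, of j "-1"] by simp
      ultimately have "x - y \<in> span C"
        using C(3) subspace_diff[OF W x(1) yW] by auto
      moreover have "y \<in> span (f ` E)"
        unfolding y_def by (intro span_sum span_scale span_base) auto
      ultimately have "(x - y) + y \<in> span (C \<union> f ` E)"
        by (meson span_add span_mono subsetD sup_ge1 sup_ge2)
      then show ?thesis by simp
    qed
    moreover have "card (C \<union> f ` E) \<le> Suc j * card B"
    proof -
      have "card (C \<union> f ` E) \<le> card C + card (f ` E)" by (rule card_Un_le)
      also have "card (f ` E) \<le> card B" using card_image_le[OF finE, of f] cardE by linarith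
      finally show ?thesis using C(2) by simp
    qed
    ultimately show ?case using C(1) finE by (intro exI[of _ "C \<union> f ` E"]) auto
  qed
  from this[of k] show ?thesis using nil by (auto simp: subset_iff)
qed

section \<open>Lie algebras of nilpotent matrices\<close>

definition comm :: "complex^'n^'n \<Rightarrow> complex^'n^'n \<Rightarrow> complex^'n^'n" where
  "comm X Y = X ** Y - Y ** X"

lemma matrix_rdistrib: "(M + N) ** K = M ** K + N ** (K :: complex^'n^'n)"
  by (simp add: matrix_matrix_mult_def vec_eq_iff sum.distrib distrib_right)

lemma matrix_scaleR_left: "(c *\<^sub>R M) ** K = c *\<^sub>R (M ** (K :: complex^'n^'n))"
  by (simp add: matrix_matrix_mult_def vec_eq_iff scaleR_sum_right)

lemma matrix_scaleR_right: "M ** (c *\<^sub>R K) = c *\<^sub>R (M ** (K :: complex^'n^'n))"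
  by (simp add: matrix_matrix_mult_def vec_eq_iff scaleR_sum_right)

lemma comm_bilinear:
  "comm (X + X') Y = comm X Y + comm X' Y"
  "comm Y (X + X') = comm Y X + comm Y X'"
  "comm (c *\<^sub>R X) Y = c *\<^sub>R comm X Y"
  "comm Y (c *\<^sub>R X) = c *\<^sub>R comm Y X"
  by (simp_all add: comm_def matrix_rdistrib matrix_add_ldistrib matrix_scaleR_left
      matrix_scaleR_right algebra_simps)

lemma linear_comm: "linear (comm X)" "linear (\<lambda>Y. comm Y X)"
  by (simp_all add: linear_iff comm_bilinear)

lemma comm_0 [simp]: "comm X 0 = 0" "comm 0 X = 0" "comm X X = 0"
  using linear_0[OF linear_comm(1)] linear_0[OF linear_comm(2)] by (auto simp: comm_def)

lemma comm_minus: "comm Y X = - comm X Y"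
  by (simp add: comm_def)

lemma matrix_ldiff: "M ** (N - K) = M ** N - M ** (K :: complex^'n^'n)"
  and matrix_rdiff: "(N - K) ** M = N ** M - K ** M"
  by (simp_all add: matrix_matrix_mult_def vec_eq_iff sum_subtractf algebra_simps)

lemma jacobi: "comm X (comm Y Z) = comm (comm X Y) Z + comm Y (comm X Z)"
  by (simp add: comm_def matrix_ldiff matrix_rdiff matrix_mul_assoc algebra_simps)

lemma comm_left_in_span:
  assumes "\<And>x. x \<in> S \<Longrightarrow> comm x y \<in> U" "subspace U" "x \<in> span S"
  shows "comm x y \<in> U"
  using assms(3)
proof (induction rule: span_induct)
  case base
  have "{x. comm x y \<in> U} = (\<lambda>x. comm x y) -` U" by auto
  then show ?case by (simp add: linear_subspace_vimage linear_comm assms(2))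
qed (rule assms(1))

lemma comm_right_in_span:
  assumes "\<And>y. y \<in> S \<Longrightarrow> comm x y \<in> U" "subspace U" "y \<in> span S"
  shows "comm x y \<in> U"
proof -
  have "comm y x \<in> U"
    by (rule comm_left_in_span[OF _ assms(2,3)])
       (metis assms(1,2) comm_minus subspace_neg)
  then show ?thesis by (metis assms(2) comm_minus subspace_neg)
qed

definition mpow :: "complex^'n^'n \<Rightarrow> nat \<Rightarrow> complex^'n^'n" where
  "mpow B m = ((\<lambda>M. B ** M) ^^ m) (mat 1)"

lemma funpow_mult_left: "((\<lambda>M. B ** M) ^^ m) Y = mpow B m ** Y"
  by (induction m) (auto simp: mpow_def matrix_mul_assoc)

lemma mpow_Suc: "mpow B (Suc m) = B ** mpow B m" "mpow B (Suc m) = mpow B m ** B"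
proof -
  show "mpow B (Suc m) = B ** mpow B m" by (simp add: mpow_def)
  have "mpow B (Suc m) = ((\<lambda>M. B ** M) ^^ m) (B ** mat 1)"
    unfolding mpow_def by (simp only: funpow_Suc_right o_apply)
  then show "mpow B (Suc m) = mpow B m ** B" by (simp add: funpow_mult_left)
qed

lemma funpow_comm_linear:
  "(comm X ^^ k) (Y - Z) = (comm X ^^ k) Y - (comm X ^^ k) Z"
  by (induction k) (simp_all add: linear_diff[OF linear_comm(1)])

text \<open>
  Left and right multiplication by \<open>B\<close> commute, so the binomial expansion of \<open>(L - R) ^ (a + b)\<close>
  vanishes as soon as \<open>L ^ a\<close> and \<open>R ^ b\<close> do; the induction avoids the expansion itself.
\<close>
lemma ad_nilpotent:
  assumes "mpow B a ** Y = 0" "Y ** mpow B b = 0"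
  shows "(comm B ^^ (a + b)) Y = 0"
  using assms
proof (induction "a + b" arbitrary: a b Y)
  case 0
  then show ?case by (simp add: mpow_def)
next
  case (Suc s)
  have fz: "(comm B ^^ k) 0 = 0" for k by (induction k) simp_all
  show ?case
  proof (cases "a = 0 \<or> b = 0")
    case True
    then have "Y = 0" using Suc.prems by (auto simp: mpow_def)
    then show ?thesis by (simp add: fz)
  next
    case False
    then obtain a' b' where ab: "a = Suc a'" "b = Suc b'" by (meson not0_implies_Suc)
    have 1: "(comm B ^^ (a' + b)) (B ** Y) = 0"
    proof (rule Suc.hyps(1))
      show "s = a' + b" using Suc.hyps ab by simp
      show "mpow B a' ** (B ** Y) = 0"
        using Suc.prems(1) unfolding ab by (simp add: mpow_Suc(2) matrix_mul_assoc)
      show "B ** Y ** mpow B b = 0"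
        using Suc.prems(2) by (simp flip: matrix_mul_assoc)
    qed
    have 2: "(comm B ^^ (a + b')) (Y ** B) = 0"
    proof (rule Suc.hyps(1))
      show "s = a + b'" using Suc.hyps ab by simp
      show "mpow B a ** (Y ** B) = 0"
        using Suc.prems(1) by (simp add: matrix_mul_assoc)
      show "Y ** B ** mpow B b' = 0"
        using Suc.prems(2) unfolding ab by (simp add: mpow_Suc(1) flip: matrix_mul_assoc)
    qed
    have "(comm B ^^ (a + b)) Y = (comm B ^^ s) (comm B Y)"
      using Suc.hyps(2) by (metis funpow_Suc_right o_apply)
    also have "\<dots> = (comm B ^^ s) (B ** Y) - (comm B ^^ s) (Y ** B)"
      by (simp add: funpow_comm_linear comm_def)
    also have "\<dots> = 0" using 1 2 Suc.hyps(2) ab by simp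
    finally show ?thesis .
  qed
qed

lemma nilpotent_matrix_ad:
  assumes "nilpotent_matrix B"
  obtains k where "\<And>Y. (comm B ^^ k) Y = 0"
proof -
  obtain m where m: "mpow B m = 0" using assms by (auto simp: nilpotent_matrix_def mpow_def)
  show ?thesis
    by (rule that[of "m + m"]) (rule ad_nilpotent, simp_all add: m)
qed

text \<open>
  The engine of Engel's theorem, applied to the action of \<open>H\<close> on the quotient \<open>W / U\<close> without
  forming the quotient. A maximal proper subalgebra \<open>K\<close> is normalized by some further element \<open>x\<close>
  (the induction hypothesis for the pair \<open>K\<close>, \<open>H\<close>), hence \<open>H = K + x\<close> by maximality. The vectors of
  \<open>W\<close> that \<open>K\<close> moves into \<open>U\<close> are stable under \<open>x\<close>, and the last one outside \<open>U\<close> the sequence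
  of iterated brackets with \<open>x\<close> is as required. Spans and dimensions of sets of matrices are real
  ones throughout.
\<close>
lemma engel_adjoint:
  fixes H U W :: "(complex^'n^'n) set"
  assumes "subspace H" "\<And>x y. x \<in> H \<Longrightarrow> y \<in> H \<Longrightarrow> comm x y \<in> H"
    and "\<And>x. x \<in> H \<Longrightarrow> nilpotent_matrix x"
    and "subspace U" "subspace W" "U \<subset> W"
    and "\<And>x u. x \<in> H \<Longrightarrow> u \<in> U \<Longrightarrow> comm x u \<in> U"
    and "\<And>x w. x \<in> H \<Longrightarrow> w \<in> W \<Longrightarrow> comm x w \<in> W"
  shows "\<exists>v\<in>W - U. \<forall>x\<in>H. comm x v \<in> U"
  using assms
proof (induction "dim H" arbitrary: H U W rule: less_induct)
  case less
  note H = less.prems(1) and Hc = less.prems(2) and Hn = less.prems(3)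
  note U = less.prems(4) and W = less.prems(5) and UW = less.prems(6)
  note HU = less.prems(7) and HW = less.prems(8)
  show ?case
  proof (cases "H = {0}")
    case True
    then show ?thesis using UW subspace_0[OF U] by auto
  next
    case False
    define P where "P K \<longleftrightarrow> subspace K \<and> (\<forall>x\<in>K. \<forall>y\<in>K. comm x y \<in> K) \<and> K \<subset> H" for K
    have "P {0}" using False H subspace_0[OF H] by (auto simp: P_def)
    moreover have "\<forall>K. P K \<longrightarrow> dim K < Suc (dim H)"
      by (auto simp: P_def less_Suc_eq_le intro!: dim_subset)
    ultimately have "\<exists>K. P K \<and> (\<forall>K'. P K' \<longrightarrow> dim K' \<le> dim K)"
      by (rule ex_has_greatest_nat)
    then obtain K where K: "P K" and Kmax: "\<And>K'. P K' \<Longrightarrow> dim K' \<le> dim K"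
      by blast
    have Ks: "subspace K" and Kc: "\<And>x y. x \<in> K \<Longrightarrow> y \<in> K \<Longrightarrow> comm x y \<in> K" and KH: "K \<subset> H"
      using K by (auto simp: P_def)
    have dimK: "dim K < dim H"
      using KH Ks H by (metis dim_psubset span_eq_iff)
    have KHx: "x \<in> H" if "x \<in> K" for x using that KH by blast
    have "\<exists>v\<in>H - K. \<forall>x\<in>K. comm x v \<in> K"
      by (rule less.hyps[OF dimK Ks _ _ Ks H KH]) (auto intro: Kc Hn Hc KHx)
    then obtain x where x: "x \<in> H" "x \<notin> K" "\<And>k. k \<in> K \<Longrightarrow> comm k x \<in> K" by blast
    have K'sub: "K \<subseteq> span (insert x K)" by (meson span_superset subset_insertI subset_trans)
    have Kx: "comm a b \<in> K" if "a \<in> insert x K" "b \<in> insert x K" for a b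
      using that x(3) Kc Ks by (auto simp: subspace_0) (metis comm_minus subspace_neg)
    have K'c: "comm a b \<in> span (insert x K)" if "a \<in> span (insert x K)" "b \<in> span (insert x K)" for a b
    proof -
      have "comm a b \<in> K"
        by (rule comm_left_in_span[OF _ Ks that(1)], rule comm_right_in_span[OF _ Ks that(2)])
           (rule Kx)
      then show ?thesis using K'sub by blast
    qed
    have HK': "H = span (insert x K)"
    proof (rule ccontr)
      assume ne: "H \<noteq> span (insert x K)"
      have "span (insert x K) \<subseteq> H"
        by (rule span_minimal) (use x KH H in auto)
      with ne have "P (span (insert x K))" using K'c by (auto simp: P_def)
      from Kmax[OF this] have "dim (insert x K) \<le> dim K" by (simp add: dim_span)
      moreover have "x \<notin> span K" using x(2) Ks by (metis span_eq_iff)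
      ultimately show False by (simp add: dim_insert)
    qed
    have "\<exists>v\<in>W - U. \<forall>x\<in>K. comm x v \<in> U"
      by (rule less.hyps[OF dimK Ks _ _ U W UW]) (auto intro: Kc Hn HU HW KHx)
    then obtain v0 where v0: "v0 \<in> W" "v0 \<notin> U" "\<And>k. k \<in> K \<Longrightarrow> comm k v0 \<in> U" by blast
    define v where "v j = (comm x ^^ j) v0" for j
    have vW: "v j \<in> W" for j
      by (induction j) (auto simp: v_def v0 HW x)
    have vK: "comm k (v j) \<in> U" if "k \<in> K" for j k
      using that
    proof (induction j arbitrary: k)
      case 0
      then show ?case by (simp add: v_def v0)
    next
      case (Suc j)
      have "comm k (v (Suc j)) = comm (comm k x) (v j) + comm x (comm k (v j))"
        using jacobi[of k x "v j"] by (simp add: v_def)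
      then show ?case using Suc x U HU by (simp add: subspace_add)
    qed
    obtain n where "v n = 0" using nilpotent_matrix_ad[OF Hn[OF x(1)]] by (metis v_def)
    then have ex: "\<exists>n. v n \<in> U" using subspace_0[OF U] by metis
    define j where "j = (LEAST n. v n \<in> U)"
    have jU: "v j \<in> U" unfolding j_def using ex by (rule LeastI_ex)
    have "j \<noteq> 0" using jU v0 by (auto simp: v_def intro: ccontr)
    then obtain i where i: "j = Suc i" using not0_implies_Suc by blast
    have "v i \<notin> U" using not_less_Least[of i "\<lambda>n. v n \<in> U"] i by (simp add: j_def)
    moreover have "comm h (v i) \<in> U" if "h \<in> H" for h
    proof (rule comm_left_in_span[OF _ U that[unfolded HK']])
      fix a assume "a \<in> insert x K"
      then show "comm a (v i) \<in> U" using vK jU i by (auto simp: v_def)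
    qed
    ultimately show ?thesis using vW by blast
  qed
qed

text \<open>
  The newest element comes first: the real spans of the tails form a chain of Lie algebras, each
  an ideal in the next.
\<close>
fun subnormal_chain :: "(complex^'n^'n) list \<Rightarrow> bool" where
  "subnormal_chain [] = True"
| "subnormal_chain (x # xs) =
     (subnormal_chain xs \<and> (\<forall>y\<in>set xs. comm y x \<in> span (set xs)))"

lemma subnormal_chain_comm:
  assumes "subnormal_chain xs" "a \<in> span (set xs)" "b \<in> span (set xs)"
  shows "comm a b \<in> span (set xs)"
proof -
  have "comm a b \<in> span (set xs)" if "a \<in> set xs" "b \<in> set xs" "subnormal_chain xs" for a b xs
    using that(3,1,2)
  proof (induction xs arbitrary: a b)
    case (Cons x xs)
    have sub: "span (set xs) \<subseteq> span (set (x # xs))" by (simp add: span_mono subset_insertI)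
    have "comm a b \<in> span (set xs)"
    proof (cases "a = x")
      case True
      then show ?thesis using Cons by (auto simp: span_zero) (metis comm_minus span_neg)
    next
      case False
      then show ?thesis using Cons by auto
    qed
    then show ?case using sub by blast
  qed simp
  then show ?thesis
    using assms(1) by (intro comm_left_in_span[OF _ subspace_span assms(2)]
        comm_right_in_span[OF _ subspace_span assms(3)])
qed

lemma subnormal_chain_exists:
  fixes H :: "(complex^'n^'n) set"
  assumes H: "subspace H" and Hc: "\<And>x y. x \<in> H \<Longrightarrow> y \<in> H \<Longrightarrow> comm x y \<in> H"
    and Hn: "\<And>x. x \<in> H \<Longrightarrow> nilpotent_matrix x"
  obtains xs where "subnormal_chain xs" "span (set xs) = H"
proof -
  define P where "P xs \<longleftrightarrow> subnormal_chain xs \<and> set xs \<subseteq> H" for xs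
  have "P []" by (simp add: P_def)
  moreover have "\<forall>xs. P xs \<longrightarrow> dim (set xs) < Suc (dim H)"
    by (auto simp: P_def less_Suc_eq_le intro!: dim_subset)
  ultimately have "\<exists>xs. P xs \<and> (\<forall>ys. P ys \<longrightarrow> dim (set ys) \<le> dim (set xs))"
    by (rule ex_has_greatest_nat)
  then obtain xs where xs: "P xs" and max: "\<And>ys. P ys \<Longrightarrow> dim (set ys) \<le> dim (set xs)"
    by blast
  let ?S = "span (set xs)"
  have sub: "?S \<subseteq> H" using xs H by (simp add: P_def span_minimal)
  have "?S = H"
  proof (rule ccontr)
    assume "?S \<noteq> H"
    with sub have SH: "?S \<subset> H" by blast
    have c: "comm x y \<in> ?S" if "x \<in> ?S" "y \<in> ?S" for x y
      using subnormal_chain_comm xs that by (auto simp: P_def)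
    have "\<exists>v\<in>H - ?S. \<forall>x\<in>?S. comm x v \<in> ?S"
      by (rule engel_adjoint[OF _ _ _ _ H SH]) (use c sub in \<open>auto intro!: Hc Hn\<close>)
    then obtain v where v: "v \<in> H" "v \<notin> ?S" "\<forall>x\<in>?S. comm x v \<in> ?S" by blast
    have "P (v # xs)" using xs v by (auto simp: P_def span_base)
    from max[OF this] show False using v(2) by (simp add: dim_insert)
  qed
  then show ?thesis using that xs by (auto simp: P_def)
qed

lemma coeff_prod_linear:
  assumes "finite S"
  shows "coeff (\<Prod>i\<in>S. [:a i, b i:]) 1 = (\<Sum>i\<in>S. (\<Prod>j\<in>S - {i}. a j) * (b i :: complex))"
proof -
  have "coeff p 1 = poly (pderiv p) 0" for p :: "complex poly"
    by (simp add: coeff_pderiv poly_0_coeff_0)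
  then show ?thesis
    by (simp add: pderiv_prod poly_sum poly_prod pderiv_pCons mult.commute)
qed

text \<open>
  For nilpotent \<open>B\<close> the matrix \<open>1 - t B\<close> over the polynomial ring is invertible by the geometric
  series. Its determinant is thus a unit, that is a constant, while the coefficient of \<open>t\<close> in it is
  \<open>- trace B\<close>.
\<close>
lemma nilpotent_matrix_trace:
  fixes B :: "complex^'n^'n"
  assumes "nilpotent_matrix B"
  shows "trace B = 0"
proof -
  obtain m where m: "mpow B m = 0" using assms by (auto simp: nilpotent_matrix_def mpow_def)
  define Y :: "complex poly^'n^'n" where "Y = (\<chi> i j. monom (B $ i $ j) 1)"
  have Ypow: "((\<lambda>M. Y ** M) ^^ k) (mat 1) = (\<chi> i j. monom (mpow B k $ i $ j) k)" for k
  proof (induction k)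
    case 0
    then show ?case by (auto simp: mpow_def mat_def vec_eq_iff monom_0)
  next
    case (Suc k)
    then show ?case
      by (simp add: mpow_Suc(1) matrix_matrix_mult_def vec_eq_iff Y_def mult_monom monom_sum)
  qed
  have "\<exists>S. (mat 1 - Y) ** S = mat 1 - ((\<lambda>M. Y ** M) ^^ k) (mat 1)" for k
  proof (induction k)
    case 0
    show ?case by (rule exI[of _ 0]) (simp add: matrix_matrix_mult_def vec_eq_iff)
  next
    case (Suc k)
    then obtain S where S: "(mat 1 - Y) ** S = mat 1 - ((\<lambda>M. Y ** M) ^^ k) (mat 1)" by blast
    have ld: "(P :: complex poly^'n^'n) ** (Q - R) = P ** Q - P ** R" for P Q R
      by (simp add: matrix_matrix_mult_def vec_eq_iff sum_subtractf algebra_simps)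
    have rd: "(Q - R) ** P = Q ** P - R ** (P :: complex poly^'n^'n)" for P Q R
      by (simp add: matrix_matrix_mult_def vec_eq_iff sum_subtractf algebra_simps)
    have "(mat 1 - Y) ** (mat 1 + Y ** S) = (mat 1 - Y) + (mat 1 - Y) ** (Y ** S)"
      by (simp add: matrix_add_ldistrib)
    also have "(mat 1 - Y) ** (Y ** S) = Y ** ((mat 1 - Y) ** S)"
      by (simp add: ld rd matrix_mul_assoc)
    also have "\<dots> = Y - Y ** (((\<lambda>M. Y ** M) ^^ k) (mat 1))"
      unfolding S by (simp add: ld)
    finally show ?case by (intro exI[of _ "mat 1 + Y ** S"]) simp
  qed
  from this[of m] obtain S where "(mat 1 - Y) ** S = mat 1"
    unfolding Ypow m by (auto simp: vec_eq_iff)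
  then have "det (mat 1 - Y) * det S = 1" by (metis det_I det_mul)
  then have "det (mat 1 - Y) dvd 1" by (metis dvd_triv_left)
  then have "coeff (det (mat 1 - Y)) 1 = 0"
    by (auto simp: is_unit_poly_iff)
  moreover have "coeff (det (mat 1 - Y)) 1 = - trace B"
  proof -
    define c where "c p = (\<Sum>i\<in>UNIV. (\<Prod>j\<in>UNIV - {i}. if j = p j then 1 else 0) * (- B $ i $ p i))"
      for p :: "'n \<Rightarrow> 'n"
    have "(mat 1 - Y) $ i $ j = [:if i = j then 1 else 0, - B $ i $ j:]" for i j
      by (simp add: Y_def mat_def monom_altdef one_pCons)
    then have "coeff (det (mat 1 - Y)) 1
      = (\<Sum>p | p permutes UNIV. of_int (sign p) * c p)"
      unfolding det_def c_def
      by (simp add: coeff_sum of_int_poly coeff_prod_linear[unfolded One_nat_def] cong: if_cong)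
    \<comment> \<open>A permutation other than the identity moves at least two points, so it contributes only
      from the coefficient of \<open>t ^ 2\<close> on.\<close>
    also have "\<dots> = (\<Sum>p\<in>{id}. of_int (sign p) * c p)"
    proof (rule sum.mono_neutral_right)
      show "\<forall>p\<in>{p. p permutes UNIV} - {id}. of_int (sign p) * c p = 0"
      proof
        fix p :: "'n \<Rightarrow> 'n" assume p: "p \<in> {p. p permutes UNIV} - {id}"
        then obtain i where i: "p i \<noteq> i" by (metis DiffD2 eq_id_iff singletonI)
        have "inj p" using p by (auto intro: permutes_inj)
        then have pi: "p (p i) \<noteq> p i" using i by (metis injD)
        have "\<exists>j\<in>UNIV - {a}. j \<noteq> p j" for a
          using i pi by (cases "a = i") (auto intro: bexI[of _ "p i"] bexI[of _ i])
        then have "(\<Prod>j\<in>UNIV - {a}. if j = p j then 1 else (0::complex)) = 0" for a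
          by (intro prod_zero) auto
        then have "c p = 0" unfolding c_def by (intro sum.neutral) (metis mult_zero_left)
        then show "of_int (sign p) * c p = 0" by simp
      qed
    qed (auto simp: finite_permutations permutes_id)
    also have "\<dots> = - trace B"
      by (simp add: c_def trace_def sum_negf sign_id)
    finally show ?thesis .
  qed
  ultimately show ?thesis by simp
qed

section \<open>Polynomial functions and linear vector fields\<close>

lemma eval_form_linear:
  "eval_form u (v + w) = eval_form u v + eval_form u w"
  "eval_form (u + u') v = eval_form u v + eval_form u' v"
  "eval_form u (c *s v) = c * eval_form u v"
  "eval_form (c *s u) v = c * eval_form u v"
  "eval_form u 0 = 0" "eval_form 0 v = 0"
  "eval_form u (v - w) = eval_form u v - eval_form u w"
  "eval_form (u - u') v = eval_form u v - eval_form u' v"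
  by (simp_all add: eval_form_def sum.distrib sum_subtractf sum_distrib_left algebra_simps)

lemma eval_form_axis: "eval_form u (axis k 1) = u $ k" "eval_form (axis k 1) u = u $ k"
  by (simp_all add: eval_form_def axis_def if_distrib if_distribR cong: if_cong)

lemma matrix_vector_eval_form: "(X *v z) $ k = eval_form (X $ k) z"
  by (simp add: matrix_vector_mult_def eval_form_def)

definition has_differential where
  "has_differential f u z \<longleftrightarrow>
     (\<forall>v. ((\<lambda>t. f (z + t *s v)) has_field_derivative eval_form u v) (at 0))"

lemma has_differential_unique:
  assumes "has_differential f u z" shows "differential f z = u"
proof -
  have "((\<lambda>t. f (z + t *s axis k 1)) has_field_derivative u $ k) (at 0)" for k
    using assms unfolding has_differential_def by (metis eval_form_axis(1))
  then show ?thesis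
    by (simp add: differential_def partial_deriv_def vec_eq_iff DERIV_imp_deriv)
qed

lemma has_differential_const: "has_differential (\<lambda>z. c) 0 z"
  by (simp add: has_differential_def eval_form_linear)

lemma has_differential_linear: "has_differential (eval_form u) u z"
  unfolding has_differential_def eval_form_linear by (auto intro!: derivative_eq_intros)

lemma has_differential_add:
  "has_differential f u z \<Longrightarrow> has_differential g v z \<Longrightarrow> has_differential (\<lambda>w. f w + g w) (u + v) z"
  unfolding has_differential_def eval_form_linear by (auto intro!: derivative_eq_intros)

lemma has_differential_mult:
  "has_differential f u z \<Longrightarrow> has_differential g v z \<Longrightarrow>
     has_differential (\<lambda>w. f w * g w) (f z *s v + g z *s u) z"
  unfolding has_differential_def eval_form_linear
  by (auto intro!: derivative_eq_intros DERIV_mult'[THEN DERIV_cong])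

lemma has_differential_divide:
  "has_differential f u z \<Longrightarrow> has_differential g v z \<Longrightarrow> g z \<noteq> 0 \<Longrightarrow>
     has_differential (\<lambda>w. f w / g w) ((1 / (g z)\<^sup>2) *s (g z *s u - f z *s v)) z"
  unfolding has_differential_def eval_form_linear
  by (auto intro!: DERIV_divide[THEN DERIV_cong] simp: field_simps power2_eq_square)

text \<open>
  Inductive descriptions of the polynomial functions: identities between derivations can then be
  checked on coordinates and propagated by the Leibniz rule.
\<close>
inductive is_poly :: "(complex^'n \<Rightarrow> complex) \<Rightarrow> bool" where
  is_poly_const: "is_poly (\<lambda>z. c)"
| is_poly_coord: "is_poly (\<lambda>z. z $ k)"
| is_poly_add: "is_poly f \<Longrightarrow> is_poly g \<Longrightarrow> is_poly (\<lambda>z. f z + g z)"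
| is_poly_mult: "is_poly f \<Longrightarrow> is_poly g \<Longrightarrow> is_poly (\<lambda>z. f z * g z)"

inductive is_hpoly :: "nat \<Rightarrow> (complex^'n \<Rightarrow> complex) \<Rightarrow> bool" where
  is_hpoly_const: "is_hpoly 0 (\<lambda>z. c)"
| is_hpoly_coord: "is_hpoly 1 (\<lambda>z. z $ k)"
| is_hpoly_add: "is_hpoly d f \<Longrightarrow> is_hpoly d g \<Longrightarrow> is_hpoly d (\<lambda>z. f z + g z)"
| is_hpoly_mult: "is_hpoly d f \<Longrightarrow> is_hpoly e g \<Longrightarrow> is_hpoly (d + e) (\<lambda>z. f z * g z)"

lemma is_hpoly_is_poly: "is_hpoly d f \<Longrightarrow> is_poly f"
  by (induction rule: is_hpoly.induct) (auto intro: is_poly.intros)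

lemma is_poly_sum: "(\<And>i. i \<in> S \<Longrightarrow> is_poly (f i)) \<Longrightarrow> is_poly (\<lambda>z. \<Sum>i\<in>S. f i z)"
  by (induction S rule: infinite_finite_induct) (auto intro: is_poly.intros)

lemma is_poly_prod: "(\<And>i. i \<in> S \<Longrightarrow> is_poly (f i)) \<Longrightarrow> is_poly (\<lambda>z. \<Prod>i\<in>S. f i z)"
  by (induction S rule: infinite_finite_induct) (auto intro: is_poly.intros)

lemma is_poly_power: "is_poly f \<Longrightarrow> is_poly (\<lambda>z. f z ^ k)"
  by (induction k) (auto intro: is_poly.intros)

lemma is_poly_diff: "is_poly f \<Longrightarrow> is_poly g \<Longrightarrow> is_poly (\<lambda>z. f z - g z)"
  using is_poly_add[OF _ is_poly_mult[OF is_poly_const[of "-1"]], of f g] by simp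

lemma poly_fun_is_poly: "poly_fun p \<Longrightarrow> is_poly p"
  unfolding poly_fun_def by (auto intro!: is_poly_sum is_poly_prod is_poly_power is_poly.intros)

lemma is_hpoly_scale: "is_hpoly d f \<Longrightarrow> is_hpoly d (\<lambda>z. c * f z)"
  using is_hpoly_mult[OF is_hpoly_const] by fastforce

lemma is_hpoly_power: "is_hpoly k (\<lambda>z. (z $ i) ^ k)"
proof (induction k)
  case (Suc k)
  then show ?case using is_hpoly_mult[OF is_hpoly_coord Suc] by simp
qed (simp add: is_hpoly_const)

lemma is_hpoly_zero: "is_hpoly d (\<lambda>z. 0)"
  using is_hpoly_scale[OF is_hpoly_power, of d 0] by simp

lemma is_hpoly_sum: "(\<And>i. i \<in> S \<Longrightarrow> is_hpoly d (f i)) \<Longrightarrow> is_hpoly d (\<lambda>z. \<Sum>i\<in>S. f i z)"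
  by (induction S rule: infinite_finite_induct) (auto intro: is_hpoly_zero is_hpoly_add)

lemma is_hpoly_monomial: "finite S \<Longrightarrow> is_hpoly (sum a S) (\<lambda>z. \<Prod>i\<in>S. (z $ i) ^ a i)"
  by (induction S rule: finite_induct) (auto intro: is_hpoly_const is_hpoly_mult is_hpoly_power)

lemma is_hpoly_linear: "is_hpoly 1 (eval_form u)"
  unfolding eval_form_def by (intro is_hpoly_sum is_hpoly_scale is_hpoly_coord)

lemma homogeneous_poly_is_hpoly:
  assumes "homogeneous_poly d p" shows "is_hpoly d p"
proof -
  obtain c where p: "p = (\<lambda>z. \<Sum>a | sum a UNIV = d. c a * (\<Prod>i\<in>UNIV. (z $ i) ^ a i))"
    using assms unfolding homogeneous_poly_def by blast
  show ?thesis unfolding p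
    by (intro is_hpoly_sum is_hpoly_scale) (use is_hpoly_monomial[OF finite] in blast)
qed

lemma homogeneous_poly_add:
  assumes "homogeneous_poly d f" "homogeneous_poly d g"
  shows "homogeneous_poly d (\<lambda>z. f z + g z)"
proof -
  obtain c c' where "f = (\<lambda>z. \<Sum>a | sum a UNIV = d. c a * (\<Prod>i\<in>UNIV. (z $ i) ^ a i))"
    "g = (\<lambda>z. \<Sum>a | sum a UNIV = d. c' a * (\<Prod>i\<in>UNIV. (z $ i) ^ a i))"
    using assms unfolding homogeneous_poly_def by blast
  then show ?thesis unfolding homogeneous_poly_def
    by (intro exI[of _ "\<lambda>a. c a + c' a"]) (simp add: sum.distrib algebra_simps)
qed

lemma homogeneous_poly_scaled_monomial:
  fixes a :: "'n::finite \<Rightarrow> nat"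
  assumes "sum a UNIV = d"
  shows "homogeneous_poly d (\<lambda>z. c * (\<Prod>i\<in>UNIV. (z $ i) ^ a i))"
proof -
  have "{b :: 'n \<Rightarrow> nat. sum b UNIV = d} \<subseteq> PiE UNIV (\<lambda>_. {..d})"
    by (auto simp: PiE_def intro: member_le_sum)
  then have "finite {b :: 'n \<Rightarrow> nat. sum b UNIV = d}"
    by (rule finite_subset) (intro finite_PiE, auto)
  then show ?thesis unfolding homogeneous_poly_def
    by (intro exI[of _ "\<lambda>b. if b = a then c else 0"])
       (simp add: if_distrib if_distribR assms cong: if_cong)
qed

lemma homogeneous_poly_zero: "homogeneous_poly d (\<lambda>z. 0)"
  unfolding homogeneous_poly_def by (rule exI[of _ "\<lambda>a. 0"]) simp

lemma homogeneous_poly_sum: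
  "(\<And>i. i \<in> S \<Longrightarrow> homogeneous_poly d (f i)) \<Longrightarrow> homogeneous_poly d (\<lambda>z. \<Sum>i\<in>S. f i z)"
  by (induction S rule: infinite_finite_induct)
     (auto intro: homogeneous_poly_zero homogeneous_poly_add)

lemma homogeneous_poly_mult:
  assumes "homogeneous_poly d f" "homogeneous_poly e g"
  shows "homogeneous_poly (d + e) (\<lambda>z. f z * g z)"
proof -
  obtain c c' where f: "f = (\<lambda>z. \<Sum>a | sum a UNIV = d. c a * (\<Prod>i\<in>UNIV. (z $ i) ^ a i))"
    and g: "g = (\<lambda>z. \<Sum>a | sum a UNIV = e. c' a * (\<Prod>i\<in>UNIV. (z $ i) ^ a i))"
    using assms unfolding homogeneous_poly_def by blast
  have "(\<lambda>z. f z * g z) = (\<lambda>z. \<Sum>a | sum a UNIV = d. \<Sum>b | sum b UNIV = e.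
      (c a * c' b) * (\<Prod>i\<in>UNIV. (z $ i) ^ (a i + b i)))"
    unfolding f unfolding g sum_product
    by (intro ext sum.cong refl) (simp add: power_add prod.distrib)
  then show ?thesis
    by (simp only:) (intro homogeneous_poly_sum homogeneous_poly_scaled_monomial,
      simp add: sum.distrib)
qed

lemma is_hpoly_homogeneous_poly: "is_hpoly d f \<Longrightarrow> homogeneous_poly d f"
proof (induction rule: is_hpoly.induct)
  case (is_hpoly_const c)
  show ?case using homogeneous_poly_scaled_monomial[of "\<lambda>_. 0" 0 c] by simp
next
  case (is_hpoly_coord k)
  have "(z $ k) = (\<Prod>i\<in>UNIV. (z $ i) ^ (if i = k then 1 else 0))" for z :: "complex^'a"
    by (simp add: if_distrib cong: if_cong)
  then show ?case
    using homogeneous_poly_scaled_monomial[of "\<lambda>i. if i = k then 1 else 0" 1 1] by simp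
qed (auto intro: homogeneous_poly_add homogeneous_poly_mult)

lemma is_poly_has_differential: "is_poly f \<Longrightarrow> has_differential f (differential f z) z"
proof -
  assume "is_poly f"
  then have "\<exists>u. has_differential f u z"
  proof (induction rule: is_poly.induct)
    case (is_poly_coord k)
    show ?case using has_differential_linear[of "axis k 1"] by (auto simp: eval_form_axis[abs_def])
  qed (blast intro: has_differential_const has_differential_add has_differential_mult)+
  then show ?thesis using has_differential_unique by blast
qed

lemma differential_const: "differential (\<lambda>z. c) z = 0"
  and differential_linear: "differential (eval_form u) z = u"
  by (auto intro: has_differential_unique has_differential_const has_differential_linear)

lemma differential_coord: "differential (\<lambda>z. z $ k) z = axis k 1"
  using differential_linear[of "axis k 1"] by (simp add: eval_form_axis[abs_def])

lemma differential_add: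
  "is_poly f \<Longrightarrow> is_poly g \<Longrightarrow> differential (\<lambda>w. f w + g w) z = differential f z + differential g z"
  and differential_mult:
  "is_poly f \<Longrightarrow> is_poly g \<Longrightarrow>
     differential (\<lambda>w. f w * g w) z = f z *s differential g z + g z *s differential f z"
  and differential_divide:
  "is_poly f \<Longrightarrow> is_poly g \<Longrightarrow> g z \<noteq> 0 \<Longrightarrow> differential (\<lambda>w. f w / g w) z
     = (1 / (g z)\<^sup>2) *s (g z *s differential f z - f z *s differential g z)"
  by (rule has_differential_unique; rule has_differential_add has_differential_mult
      has_differential_divide; (assumption | erule is_poly_has_differential))+

lemma is_poly_differential: "is_poly f \<Longrightarrow> is_poly (\<lambda>z. differential f z $ k)"
  by (induction rule: is_poly.induct)
     (auto simp: differential_const differential_coord differential_add differential_mult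
       intro!: is_poly.intros)

definition lie_deriv :: "complex^'n^'n \<Rightarrow> (complex^'n \<Rightarrow> complex) \<Rightarrow> complex^'n \<Rightarrow> complex" where
  "lie_deriv X f z = eval_form (differential f z) (X *v z)"

lemma lie_deriv_const: "lie_deriv X (\<lambda>z. c) = (\<lambda>z. 0)"
  and lie_deriv_coord: "lie_deriv X (\<lambda>z. z $ k) = eval_form (X $ k)"
  and lie_deriv_linear: "lie_deriv X (eval_form u) = (\<lambda>z. eval_form u (X *v z))"
  and lie_deriv_add: "is_poly f \<Longrightarrow> is_poly g \<Longrightarrow>
    lie_deriv X (\<lambda>z. f z + g z) = (\<lambda>z. lie_deriv X f z + lie_deriv X g z)"
  and lie_deriv_mult: "is_poly f \<Longrightarrow> is_poly g \<Longrightarrow>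
    lie_deriv X (\<lambda>z. f z * g z) = (\<lambda>z. f z * lie_deriv X g z + lie_deriv X f z * g z)"
  by (auto simp: lie_deriv_def fun_eq_iff differential_const differential_coord differential_linear
      differential_add differential_mult eval_form_linear eval_form_axis matrix_vector_eval_form)

lemma lie_deriv_scale: "is_poly f \<Longrightarrow> lie_deriv X (\<lambda>z. c * f z) = (\<lambda>z. c * lie_deriv X f z)"
  by (simp add: lie_deriv_mult is_poly_const lie_deriv_const)

lemma is_hpoly_lie_deriv: "is_hpoly d f \<Longrightarrow> is_hpoly d (lie_deriv X f)"
proof (induction rule: is_hpoly.induct)
  case (is_hpoly_mult d f e g)
  then show ?case
    by (simp add: lie_deriv_mult is_hpoly_is_poly) (intro is_hpoly.intros)
qed (auto simp: lie_deriv_const lie_deriv_coord lie_deriv_add is_hpoly_is_poly intro: is_hpoly.intros is_hpoly_linear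
     simp del: One_nat_def)

lemma is_poly_linear: "is_poly (eval_form u)"
  by (rule is_hpoly_is_poly[OF is_hpoly_linear])

lemma is_poly_lie_deriv: "is_poly f \<Longrightarrow> is_poly (lie_deriv X f)"
  by (induction rule: is_poly.induct)
     (auto simp: lie_deriv_const lie_deriv_coord lie_deriv_add lie_deriv_mult intro!: is_poly.intros is_poly_linear)

text \<open>Both sides are derivations in \<open>f\<close>, so it suffices to compare them on coordinates.\<close>
lemma lie_deriv_comm:
  "is_poly f \<Longrightarrow> lie_deriv Y (lie_deriv X f) z - lie_deriv X (lie_deriv Y f) z = lie_deriv (comm X Y) f z"
proof (induction rule: is_poly.induct)
  case (is_poly_const c)
  show ?case by (simp add: lie_deriv_const)
next
  case (is_poly_coord k)
  show ?case
    unfolding lie_deriv_coord lie_deriv_linear unfolding matrix_vector_eval_form[symmetric]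
    by (simp add: comm_def matrix_vector_mult_diff_rdistrib matrix_vector_mul_assoc)
next
  case (is_poly_add f g)
  then show ?case by (simp add: lie_deriv_add is_poly_lie_deriv algebra_simps)
next
  case (is_poly_mult f g)
  then show ?case
    by (simp add: lie_deriv_add lie_deriv_mult is_poly_lie_deriv is_poly.intros)
       (simp add: algebra_simps flip: is_poly_mult.IH)
qed

lemma euler_identity: "is_hpoly d f \<Longrightarrow> eval_form (differential f z) z = of_nat d * f z"
  by (induction rule: is_hpoly.induct)
     (simp_all add: differential_const differential_coord differential_add differential_mult is_hpoly_is_poly
       eval_form_linear eval_form_axis algebra_simps)

lemma lie_deriv_matrix_linear:
  "lie_deriv (X + Y) f z = lie_deriv X f z + lie_deriv Y f z"
  "lie_deriv (c *\<^sub>R X) f z = c *\<^sub>R lie_deriv X f z"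
proof -
  have "(c *\<^sub>R X) *v z = of_real c *s (X *v z)"
    by (simp add: matrix_vector_mult_def vec_eq_iff scaleR_conv_of_real[where 'a = complex]
        sum_distrib_left algebra_simps)
  then show "lie_deriv (c *\<^sub>R X) f z = c *\<^sub>R lie_deriv X f z"
    by (simp add: lie_deriv_def eval_form_linear scaleR_conv_of_real)
qed (simp add: lie_deriv_def eval_form_linear matrix_vector_mult_add_rdistrib)

lemma lie_deriv_span_zero:
  assumes "\<And>x. x \<in> S \<Longrightarrow> lie_deriv x f = (\<lambda>z. 0)" "x \<in> span S"
  shows "lie_deriv x f = (\<lambda>z. 0)"
  using assms(2)
proof (induction rule: span_induct)
  case base
  then show ?case
    by (auto simp: subspace_def fun_eq_iff lie_deriv_matrix_linear)
       (simp add: lie_deriv_def eval_form_linear)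
qed (rule assms(1))

lemma is_poly_funpow_lie_deriv:
  "is_poly f \<Longrightarrow> is_poly ((lie_deriv X ^^ k) f)"
  by (induction k) (auto intro: is_poly_lie_deriv)

lemma funpow_lie_deriv_add:
  "is_poly f \<Longrightarrow> is_poly g \<Longrightarrow>
    (lie_deriv X ^^ k) (\<lambda>z. f z + g z) = (\<lambda>z. (lie_deriv X ^^ k) f z + (lie_deriv X ^^ k) g z)"
  by (induction k) (simp_all add: lie_deriv_add is_poly_funpow_lie_deriv)

lemma funpow_lie_deriv_0: "(lie_deriv X ^^ k) (\<lambda>z. 0) = (\<lambda>z. 0)"
  by (induction k) (simp_all add: lie_deriv_const)

text \<open>
  Nilpotency orders behave like degrees under products; counting them as \<open>Suc a\<close> is what makes the
  bound additive, so that constants cost nothing and degree \<open>d\<close> costs \<open>d\<close> times the order on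
  coordinates.
\<close>
lemma funpow_lie_deriv_mult:
  assumes "is_poly f" "is_poly g" "(lie_deriv X ^^ Suc a) f = (\<lambda>z. 0)" "(lie_deriv X ^^ Suc b) g = (\<lambda>z. 0)"
  shows "(lie_deriv X ^^ Suc (a + b)) (\<lambda>z. f z * g z) = (\<lambda>z. 0)"
  using assms
proof (induction "a + b" arbitrary: a b f g rule: less_induct)
  case less
  note derivs = is_poly_lie_deriv[OF less.prems(1), of X] is_poly_lie_deriv[OF less.prems(2), of X]
  have 1: "(lie_deriv X ^^ (a + b)) (\<lambda>z. lie_deriv X f z * g z) = (\<lambda>z. 0)"
  proof (cases a)
    case 0
    then show ?thesis using less.prems(3) by (simp add: funpow_lie_deriv_0)
  next
    case (Suc a')
    have "(lie_deriv X ^^ Suc a') (lie_deriv X f) = (\<lambda>z. 0)"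
      using less.prems(3) unfolding Suc funpow_Suc_right[of "Suc a'"] o_apply .
    then have "(lie_deriv X ^^ Suc (a' + b)) (\<lambda>z. lie_deriv X f z * g z) = (\<lambda>z. 0)"
      using Suc by (intro less.hyps less.prems derivs) simp_all
    then show ?thesis using Suc by simp
  qed
  have 2: "(lie_deriv X ^^ (a + b)) (\<lambda>z. f z * lie_deriv X g z) = (\<lambda>z. 0)"
  proof (cases b)
    case 0
    then show ?thesis using less.prems(4) by (simp add: funpow_lie_deriv_0)
  next
    case (Suc b')
    have "(lie_deriv X ^^ Suc b') (lie_deriv X g) = (\<lambda>z. 0)"
      using less.prems(4) unfolding Suc funpow_Suc_right[of "Suc b'"] o_apply .
    then have "(lie_deriv X ^^ Suc (a + b')) (\<lambda>z. f z * lie_deriv X g z) = (\<lambda>z. 0)"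
      using Suc by (intro less.hyps less.prems derivs) simp_all
    then show ?thesis using Suc by simp
  qed
  have "(lie_deriv X ^^ Suc (a + b)) (\<lambda>z. f z * g z)
      = (lie_deriv X ^^ (a + b)) (\<lambda>z. f z * lie_deriv X g z + lie_deriv X f z * g z)"
    using less.prems by (simp only: funpow_Suc_right o_apply lie_deriv_mult)
  also have "\<dots> = (\<lambda>z. 0)"
    using less.prems derivs by (subst funpow_lie_deriv_add) (auto intro: is_poly.intros simp: 1 2)
  finally show ?case .
qed

lemma lie_deriv_nilpotent:
  assumes "mpow X m = 0" "is_hpoly d f"
  shows "(lie_deriv X ^^ Suc (d * m)) f = (\<lambda>z. 0)"
  using assms(2)
proof (induction rule: is_hpoly.induct)
  case (is_hpoly_const c)
  show ?case by (simp add: lie_deriv_const)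
next
  case (is_hpoly_coord k)
  have "(lie_deriv X ^^ j) (\<lambda>z. z $ k) = (\<lambda>z. (mpow X j *v z) $ k)" for j
  proof (induction j)
    case 0
    show ?case by (simp add: mpow_def)
  next
    case (Suc j)
    have "lie_deriv X (\<lambda>z. (mpow X j *v z) $ k) = (\<lambda>z. (mpow X j *v (X *v z)) $ k)"
      unfolding matrix_vector_eval_form by (rule lie_deriv_linear)
    then show ?case using Suc by (simp add: mpow_Suc(2) matrix_vector_mul_assoc)
  qed
  from this[of m] have "(lie_deriv X ^^ m) (\<lambda>z. z $ k) = (\<lambda>z. 0)"
    by (simp add: assms(1))
  then show ?case by (simp add: lie_deriv_const)
next
  case (is_hpoly_add d f g)
  then show ?case using funpow_lie_deriv_add[of f g "Suc (d * m)" X] by (simp add: is_hpoly_is_poly)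
next
  case (is_hpoly_mult d f e g)
  then show ?case
    using funpow_lie_deriv_mult[of f g "d * m" X "e * m"]
    by (simp add: is_hpoly_is_poly add_mult_distrib)
qed

lemma is_poly_line: "is_poly f \<Longrightarrow> \<exists>p. \<forall>t. f (a + t *s b) = poly p t"
proof (induction rule: is_poly.induct)
  case (is_poly_const c)
  show ?case by (rule exI[of _ "[:c:]"]) simp
next
  case (is_poly_coord k)
  show ?case by (rule exI[of _ "[:a $ k, b $ k:]"]) simp
next
  case (is_poly_add f g)
  then obtain p q where "\<forall>t. f (a + t *s b) = poly p t" "\<forall>t. g (a + t *s b) = poly q t" by blast
  then show ?case by (intro exI[of _ "p + q"]) simp
next
  case (is_poly_mult f g)
  then obtain p q where "\<forall>t. f (a + t *s b) = poly p t" "\<forall>t. g (a + t *s b) = poly q t" by blast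
  then show ?case by (intro exI[of _ "p * q"]) simp
qed

text \<open>
  Restricted to the line through \<open>a\<close> and \<open>b\<close>, both functions become nonzero polynomials in one
  variable. This is the form in which the irreducibility of affine space enters.
\<close>
lemma is_poly_common_nonzero:
  assumes "is_poly f" "is_poly g" "f a \<noteq> 0" "g b \<noteq> 0"
  shows "\<exists>z. f z \<noteq> 0 \<and> g z \<noteq> 0"
proof -
  obtain p where p: "\<And>t. f (a + t *s (b - a)) = poly p t" using is_poly_line[OF assms(1)] by blast
  obtain q where q: "\<And>t. g (a + t *s (b - a)) = poly q t" using is_poly_line[OF assms(2)] by blast
  have "p \<noteq> 0" using p[of 0] assms(3) by auto
  moreover have "q \<noteq> 0" using q[of 1] assms(4) by auto
  ultimately obtain t where "poly (p * q) t \<noteq> 0" by (metis mult_eq_0_iff poly_all_0_iff_0)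
  then show ?thesis using p[of t] q[of t] by (metis mult_eq_0_iff poly_mult)
qed

section \<open>Counting invariants\<close>

interpretation fs: vector_space "\<lambda>(c::complex) (f :: complex^'n \<Rightarrow> complex) z. c * f z"
  by unfold_locales (auto simp: fun_eq_iff algebra_simps)

lemma sum_fun_apply: "(\<Sum>s\<in>S. F s) z = (\<Sum>s\<in>S. F s z)"
  for F :: "'a \<Rightarrow> complex^'n \<Rightarrow> complex"
  by (induction S rule: infinite_finite_induct) auto

text \<open>Kronecker substitution: the weights are powers of \<open>q + 1\<close>, read off as digits.\<close>
lemma separating_weights:
  assumes "finite I"
  shows "\<exists>w :: 'i \<Rightarrow> nat. inj_on (\<lambda>a. \<Sum>i\<in>I. w i * a i) (PiE I (\<lambda>_. {..q}))"
  using assms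
proof (induction I rule: finite_induct)
  case empty
  show ?case by simp
next
  case (insert j I)
  then obtain w where w: "inj_on (\<lambda>a. \<Sum>i\<in>I. w i * a i) (PiE I (\<lambda>_. {..q}))" by blast
  define w' where "w' i = (if i = j then 1 else Suc q * w i)" for i
  have sum: "(\<Sum>i\<in>insert j I. w' i * a i) = a j + Suc q * (\<Sum>i\<in>I. w i * a i)" for a
  proof -
    have "(\<Sum>i\<in>I. w' i * a i) = (\<Sum>i\<in>I. Suc q * (w i * a i))"
      using insert.hyps(2) by (intro sum.cong) (auto simp: w'_def algebra_simps)
    then show ?thesis using insert.hyps by (simp add: w'_def sum_distrib_left)
  qed
  have "inj_on (\<lambda>a. \<Sum>i\<in>insert j I. w' i * a i) (PiE (insert j I) (\<lambda>_. {..q}))"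
  proof (rule inj_onI)
    fix a b :: "'i \<Rightarrow> nat"
    assume a: "a \<in> PiE (insert j I) (\<lambda>_. {..q})" and b: "b \<in> PiE (insert j I) (\<lambda>_. {..q})"
      and eq: "(\<Sum>i\<in>insert j I. w' i * a i) = (\<Sum>i\<in>insert j I. w' i * b i)"
    have lt: "a j < Suc q" "b j < Suc q" using a b by (auto simp: less_Suc_eq_le)
    note eq' = eq[unfolded sum]
    have "a j = b j"
      using arg_cong[OF eq', of "\<lambda>x. x mod Suc q"] lt by (simp del: mult_Suc)
    with eq' have s: "(\<Sum>i\<in>I. w i * a i) = (\<Sum>i\<in>I. w i * b i)" by (simp del: mult_Suc)
    have "restrict a I = restrict b I"
    proof (rule inj_onD[OF w])
      show "(\<Sum>i\<in>I. w i * restrict a I i) = (\<Sum>i\<in>I. w i * restrict b I i)" using s by simp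
    qed (use a b in auto)
    then show "a = b"
      using a b \<open>a j = b j\<close> by (intro PiE_ext[OF a b]) (metis insertE restrict_apply')
  qed
  then show ?case by blast
qed

text \<open>
  The monomials whose exponents are at most \<open>q\<close> in all variables but one, the last variable making
  up the degree, already number \<open>(q + 1) ^ (N - 1)\<close>. They are independent since on the curve
  \<open>\<gamma>\<close> they become distinct powers of \<open>t\<close>.
\<close>
lemma homogeneous_dimension_lower_bound:
  fixes C :: "(complex^'n \<Rightarrow> complex) set"
  assumes C: "finite C" "{f. is_hpoly (q * (CARD('n) - 1)) f} \<subseteq> fs.span C"
  shows "Suc q ^ (CARD('n) - 1) \<le> card C"
proof -
  define d where "d = q * (CARD('n) - 1)"
  obtain i0 :: 'n where "True" by simp
  define I where "I = UNIV - {i0}"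
  have cardI: "card I = CARD('n) - 1" and finI: "finite I" by (simp_all add: I_def)
  define P where "P = PiE I (\<lambda>_. {..q})"
  have cardP: "card P = Suc q ^ (CARD('n) - 1)" and finP: "finite P"
    using finI by (simp_all add: P_def card_PiE cardI finite_PiE)
  obtain w where w: "inj_on (\<lambda>a. \<Sum>i\<in>I. w i * a i) P"
    using separating_weights[OF finI] unfolding P_def by blast
  define e where "e a = (\<Sum>i\<in>I. w i * a i)" for a
  have inje: "inj_on e P" using w by (simp add: e_def[abs_def])
  define m :: "('n \<Rightarrow> nat) \<Rightarrow> complex^'n \<Rightarrow> complex"
    where "m a = (\<lambda>z. (\<Prod>i\<in>I. (z $ i) ^ a i) * (z $ i0) ^ (d - sum a I))" for a
  define \<gamma> :: "complex \<Rightarrow> complex^'n" where "\<gamma> t = (\<chi> i. if i = i0 then 1 else t ^ w i)" for t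
  have m\<gamma>: "m a (\<gamma> t) = t ^ e a" for a t
  proof -
    have "(\<Prod>i\<in>I. (\<gamma> t $ i) ^ a i) = (\<Prod>i\<in>I. t ^ (w i * a i))"
      by (intro prod.cong) (auto simp: \<gamma>_def I_def power_mult)
    then show ?thesis by (simp add: m_def e_def power_sum) (simp add: \<gamma>_def)
  qed
  have "is_hpoly d (m a)" if "a \<in> P" for a
  proof -
    have "sum a I \<le> (\<Sum>i\<in>I. q)" using that by (intro sum_mono) (auto simp: P_def)
    then have "sum a I + (d - sum a I) = d" by (simp add: d_def cardI mult.commute)
    then show ?thesis
      using is_hpoly_mult[OF is_hpoly_monomial[OF finI, of a] is_hpoly_power[of "d - sum a I" i0]]
      by (simp add: m_def)
  qed
  then have mC: "m ` P \<subseteq> fs.span C" using C(2) by (auto simp: d_def)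
  have "e a = e b" if "m a = m b" for a b
  proof -
    have "(2::complex) ^ e a = 2 ^ e b" using m\<gamma>[of a 2] m\<gamma>[of b 2] that by simp
    then have "norm ((2::complex) ^ e a) = norm ((2::complex) ^ e b)" by (rule arg_cong)
    then show ?thesis by (simp add: norm_power)
  qed
  with inje have injm: "inj_on m P" unfolding inj_on_def by blast
  have "fs.independent (m ` P)"
  proof (rule fs.independent_if_scalars_zero)
    show "finite (m ` P)" using finP by simp
    fix g x assume g: "(\<Sum>x\<in>m ` P. (\<lambda>z. g x * x z)) = 0" and "x \<in> m ` P"
    then obtain a where a: "a \<in> P" "x = m a" by blast
    define p where "p = (\<Sum>b\<in>P. monom (g (m b)) (e b))"
    have "poly p t = 0" for t
    proof -
      have "poly p t = (\<Sum>x\<in>m ` P. (\<lambda>z. g x * x z)) (\<gamma> t)"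
        by (simp add: p_def poly_sum poly_monom sum_fun_apply sum.reindex[OF injm] m\<gamma>)
      then show ?thesis by (simp add: g)
    qed
    then have "p = 0" using poly_all_0_iff_0 by blast
    then have "0 = coeff p (e a)" by simp
    also have "\<dots> = (\<Sum>b\<in>P. if b = a then g (m b) else 0)"
      unfolding p_def coeff_sum using inje a by (intro sum.cong) (auto simp: inj_on_def)
    also have "\<dots> = g x" using a finP by simp
    finally show "g x = 0" by simp
  qed
  then have "card (m ` P) \<le> card C" using fs.independent_span_bound[OF C(1) _ mC] by blast
  then show ?thesis by (simp add: card_image[OF injm] cardP)
qed

definition invariants :: "nat \<Rightarrow> (complex^'n^'n) list \<Rightarrow> (complex^'n \<Rightarrow> complex) set" where
  "invariants d xs = {f. is_hpoly d f \<and> (\<forall>x\<in>set xs. lie_deriv x f = (\<lambda>z. 0))}"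

lemma lie_deriv_invariants:
  assumes "subnormal_chain (x # xs)" "f \<in> invariants d xs"
  shows "lie_deriv x f \<in> invariants d xs"
proof -
  have f: "is_hpoly d f" "\<And>y. y \<in> set xs \<Longrightarrow> lie_deriv y f = (\<lambda>z. 0)"
    using assms(2) by (auto simp: invariants_def)
  have "lie_deriv y (lie_deriv x f) z = 0" if "y \<in> set xs" for y z
  proof -
    have "lie_deriv (comm y x) f = (\<lambda>z. 0)"
      using lie_deriv_span_zero[of "set xs" f] f(2) assms(1) that by auto
    then show ?thesis
      using lie_deriv_comm[OF is_hpoly_is_poly[OF f(1)], of x y z] f(2)[OF that] by (simp add: lie_deriv_const)
  qed
  then show ?thesis using f(1) by (auto simp: invariants_def is_hpoly_lie_deriv fun_eq_iff)
qed

lemma subspace_invariants: "fs.subspace (invariants d xs)"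
  unfolding fs.subspace_def invariants_def
  by (auto simp: zero_fun_def plus_fun_def is_hpoly_zero is_hpoly_add is_hpoly_scale lie_deriv_const lie_deriv_add
      lie_deriv_scale is_hpoly_is_poly)

text \<open>
  The number of elements of the chain that act nontrivially on the invariants of their
  predecessors: the steps that cost dimension in the count, and each of which enlarges the generic
  orbit.
\<close>
fun effective_steps :: "(complex^'n^'n) list \<Rightarrow> nat" where
  "effective_steps [] = 0"
| "effective_steps (x # xs) = effective_steps xs +
     (if \<exists>d. \<exists>f\<in>invariants d xs. lie_deriv x f \<noteq> (\<lambda>z. 0) then 1 else 0)"

lemma invariants_bound:
  fixes xs :: "(complex^'n^'n) list"
  assumes "subnormal_chain xs" "\<And>x. x \<in> set xs \<Longrightarrow> mpow x m = 0"
    and "finite B" "invariants d xs \<subseteq> fs.span B"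
  shows "\<exists>C. finite C \<and> card C \<le> Suc (d * m) ^ effective_steps xs * card B \<and>
           {f :: complex^'n \<Rightarrow> complex. is_hpoly d f} \<subseteq> fs.span C"
  using assms
proof (induction xs arbitrary: B)
  case (Nil B)
  then show ?case by (intro exI[of _ B]) (simp add: invariants_def)
next
  case (Cons x xs B)
  let ?K = "Suc (d * m)"
  define s where "s = (if \<exists>d. \<exists>f\<in>invariants d xs. lie_deriv x f \<noteq> (\<lambda>z. 0) then 1 else 0 :: nat)"
  have ker: "{f \<in> invariants d xs. lie_deriv x f = 0} = invariants d (x # xs)"
    by (auto simp: invariants_def zero_fun_def)
  have "\<exists>E. finite E \<and> card E \<le> ?K ^ s * card B \<and> invariants d xs \<subseteq> fs.span E"
  proof (cases "s = 0")
    case True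
    have "lie_deriv x f = (\<lambda>z. 0)" if "f \<in> invariants d xs" for f
    proof (rule ccontr)
      assume "lie_deriv x f \<noteq> (\<lambda>z. 0)"
      with that have "s = 1" unfolding s_def by (intro if_P) blast
      with True show False by simp
    qed
    then have "invariants d xs = invariants d (x # xs)"
      by (auto simp: invariants_def)
    then show ?thesis using True Cons.prems by (intro exI[of _ B]) simp
  next
    case False
    then have "s = 1" by (auto simp: s_def split: if_splits)
    moreover have "\<exists>E. finite E \<and> card E \<le> ?K * card B \<and> invariants d xs \<subseteq> fs.span E"
    proof (rule fs.nilpotent_kernel_bound[OF subspace_invariants])
      show "{f \<in> invariants d xs. lie_deriv x f = 0} \<subseteq> fs.span B"
        using Cons.prems ker by simp
      show "(lie_deriv x ^^ ?K) f = 0" if "f \<in> invariants d xs" for f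
        unfolding zero_fun_def
        by (rule lie_deriv_nilpotent) (use that Cons.prems in \<open>auto simp: invariants_def\<close>)
      show "lie_deriv x f \<in> invariants d xs" if "f \<in> invariants d xs" for f
        by (rule lie_deriv_invariants) (use that Cons.prems in auto)
    qed (use Cons.prems in \<open>auto simp: invariants_def plus_fun_def lie_deriv_add lie_deriv_scale is_hpoly_is_poly\<close>)
    ultimately show ?thesis by simp
  qed
  then obtain E where E: "finite E" "card E \<le> ?K ^ s * card B" "invariants d xs \<subseteq> fs.span E"
    by blast
  obtain C :: "(complex^'n \<Rightarrow> complex) set" where C: "finite C"
    "card C \<le> ?K ^ effective_steps xs * card E" "{f. is_hpoly d f} \<subseteq> fs.span C"
    using Cons.IH[OF _ _ E(1,3)] Cons.prems by auto
  note C(2)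
  also have "?K ^ effective_steps xs * card E \<le> ?K ^ effective_steps xs * (?K ^ s * card B)"
    using E(2) by (rule mult_left_mono) simp
  also have "\<dots> = ?K ^ effective_steps (x # xs) * card B"
    by (simp only: effective_steps.simps s_def[symmetric] power_add mult.assoc)
  finally show ?case using C by blast
qed

lemma invariants_differential_vanishes:
  assumes "f \<in> invariants d xs" "v \<in> vec.span ((\<lambda>x. x *v z) ` set xs)"
  shows "eval_form (differential f z) v = 0"
  using assms(2)
proof (induction rule: vec.span_induct)
  case base
  then show ?case by (auto simp: vec.subspace_def eval_form_linear)
next
  case (step v)
  then show ?case using assms(1) by (auto simp: invariants_def lie_deriv_def fun_eq_iff)
qed

text \<open>
  At an effective step, some \<open>f\<close> killed by the older elements has a derivative along \<open>x\<close> that is not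
  identically zero. Wherever this derivative does not vanish, \<open>df\<close> separates \<open>x z\<close> from the span
  of the older vectors. \<open>G\<close> is the product of these derivatives.
\<close>
lemma effective_steps_le_orbit_dim:
  "\<exists>G. is_poly G \<and> (\<exists>z. G z \<noteq> 0) \<and>
     (\<forall>z. G z \<noteq> 0 \<longrightarrow> effective_steps xs \<le> vec.dim ((\<lambda>x. x *v z) ` set xs))"
  for xs :: "(complex^'n^'n) list"
proof (induction xs)
  case Nil
  show ?case by (rule exI[of _ "\<lambda>z. 1"]) (auto intro: is_poly_const)
next
  case (Cons x xs)
  then obtain G where G: "is_poly G" "\<exists>z. G z \<noteq> 0"
    "\<And>z. G z \<noteq> 0 \<Longrightarrow> effective_steps xs \<le> vec.dim ((\<lambda>x. x *v z) ` set xs)" by blast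
  show ?case
  proof (cases "\<exists>d. \<exists>f\<in>invariants d xs. lie_deriv x f \<noteq> (\<lambda>z. 0)")
    case True
    then obtain d f where f: "f \<in> invariants d xs" "lie_deriv x f \<noteq> (\<lambda>z. 0)" by blast
    then obtain b where b: "lie_deriv x f b \<noteq> 0" by (auto simp: fun_eq_iff)
    have ld: "is_poly (lie_deriv x f)" using f by (auto simp: invariants_def intro: is_poly_lie_deriv is_hpoly_is_poly)
    define G' where "G' z = G z * lie_deriv x f z" for z
    have "\<exists>z. G' z \<noteq> 0" using is_poly_common_nonzero[OF G(1) ld _ b] G(2) by (auto simp: G'_def)
    moreover have "is_poly G'" unfolding G'_def using G(1) ld by (rule is_poly_mult)
    moreover have "effective_steps (x # xs) \<le> vec.dim ((\<lambda>x. x *v z) ` set (x # xs))"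
      if "G' z \<noteq> 0" for z
    proof -
      have "x *v z \<notin> vec.span ((\<lambda>x. x *v z) ` set xs)"
        using invariants_differential_vanishes[OF f(1)] that by (auto simp: G'_def lie_deriv_def)
      then have "vec.dim ((\<lambda>x. x *v z) ` set (x # xs)) = vec.dim ((\<lambda>x. x *v z) ` set xs) + 1"
        by (simp add: vec.dim_insert)
      then show ?thesis using G(3)[of z] that by (auto simp: G'_def)
    qed
    ultimately show ?thesis by blast
  next
    case False
    have "effective_steps (x # xs) \<le> vec.dim ((\<lambda>x. x *v z) ` set (x # xs))"
      if "G z \<noteq> 0" for z
    proof -
      have "effective_steps (x # xs) = effective_steps xs" using False by simp
      also have "\<dots> \<le> vec.dim ((\<lambda>x. x *v z) ` set xs)" using that by (rule G(3))
      also have "\<dots> \<le> vec.dim ((\<lambda>x. x *v z) ` set (x # xs))"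
        by (intro vec.dim_subset) auto
      finally show ?thesis .
    qed
    then show ?thesis using G(1,2) by blast
  qed
qed

text \<open>
  Lowering the dimension by finite factors never reaches zero, so even in degree one an invariant
  survives.
\<close>
lemma linear_invariant_exists:
  fixes xs :: "(complex^'n^'n) list"
  assumes "subnormal_chain xs" "\<And>x. x \<in> set xs \<Longrightarrow> mpow x m = 0"
  obtains l b where "l \<in> invariants 1 xs" "l b \<noteq> 0"
proof (rule ccontr)
  assume "\<not> thesis"
  with that have "l = 0" if "l \<in> invariants 1 xs" for l
    using \<open>l \<in> invariants 1 xs\<close> by (auto simp: fun_eq_iff)
  then have "invariants 1 xs \<subseteq> fs.span {}" by auto
  from invariants_bound[OF assms finite.emptyI this] have "{f :: complex^'n \<Rightarrow> complex. is_hpoly 1 f} \<subseteq> {0}"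
    by auto
  moreover obtain k :: 'n where True by simp
  ultimately have "(\<lambda>z :: complex^'n. z $ k) = 0" using is_hpoly_coord[of k] by blast
  from fun_cong[OF this, of "axis k 1"] show False by (simp add: axis_def)
qed

text \<open>
  The generic orbit together with the radial direction lies in the kernel of the covector \<open>A z\<close>.
  The invariant linear form shows that the radial direction is not tangent to the orbit: its
  differential kills the orbit, but takes the value \<open>l z\<close> on \<open>z\<close>.
\<close>
lemma effective_steps_bound:
  fixes A :: "complex^'n \<Rightarrow> complex^'n"
  assumes pfA: "\<And>k. is_poly (\<lambda>z. A z $ k)" and A: "A a \<noteq> 0"
    and rad: "\<And>z. eval_form (A z) z = 0"
    and tan: "\<And>x z. x \<in> set xs \<Longrightarrow> eval_form (A z) (x *v z) = 0"
    and l: "l \<in> invariants 1 xs" "l b \<noteq> 0"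
  shows "effective_steps xs + 2 \<le> CARD('n)"
proof -
  obtain G c where G: "is_poly G" "G c \<noteq> 0"
    "\<And>z. G z \<noteq> 0 \<Longrightarrow> effective_steps xs \<le> vec.dim ((\<lambda>x. x *v z) ` set xs)"
    using effective_steps_le_orbit_dim[of xs] by blast
  obtain k where k: "A a $ k \<noteq> 0" using A by (auto simp: vec_eq_iff)
  have hl: "is_hpoly 1 l" using l(1) by (simp add: invariants_def)
  obtain y where y: "G y \<noteq> 0" "l y \<noteq> 0"
    using is_poly_common_nonzero[OF G(1) is_hpoly_is_poly[OF hl] G(2) l(2)] by blast
  obtain z where z: "G z * l z \<noteq> 0" "A z $ k \<noteq> 0"
    using is_poly_common_nonzero[OF is_poly_mult[OF G(1) is_hpoly_is_poly[OF hl]] pfA, of y a k] y k by auto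
  let ?V = "(\<lambda>x. x *v z) ` set xs"
  have "eval_form (differential l z) z \<noteq> 0" using euler_identity[OF hl, of z] z by simp
  then have "z \<notin> vec.span ?V" using invariants_differential_vanishes[OF l(1)] by blast
  then have dim: "vec.dim (insert z ?V) = vec.dim ?V + 1" by (simp add: vec.dim_insert)
  have "vec.span (insert z ?V) \<subseteq> {v. eval_form (A z) v = 0}"
    by (rule vec.span_minimal) (auto simp: rad tan vec.subspace_def eval_form_linear)
  moreover have "eval_form (A z) (axis k 1) \<noteq> 0" using z by (simp add: eval_form_axis)
  ultimately have "vec.span (insert z ?V) \<noteq> UNIV" by auto
  then have "vec.span (insert z ?V) \<subset> vec.span UNIV" by auto
  then have "vec.dim (insert z ?V) < vec.dim (UNIV :: (complex^'n) set)" by (rule vec.dim_psubset)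
  then show ?thesis using dim G(3)[of z] z by (simp add: vec_dim_card del: vec.dim_UNIV)
qed

lemma two_invariants_exist:
  fixes xs :: "(complex^'n^'n) list"
  assumes chain: "subnormal_chain xs" "\<And>x. x \<in> set xs \<Longrightarrow> mpow x m = 0"
    and steps: "effective_steps xs + 2 \<le> CARD('n)"
  obtains d P Q where "P \<in> invariants d xs" "Q \<in> invariants d xs" "Q \<noteq> (\<lambda>z. 0)"
    "\<nexists>c. P = (\<lambda>z. c * Q z)"
proof -
  define N where "N = CARD('n) - 1"
  \<comment> \<open>The nilpotency order is at most \<open>(q + 1) * M\<close> in degree \<open>d = q * N\<close>, so the dimension of the
    invariants is at least \<open>(q + 1) ^ N / ((q + 1) * M) ^ r = (q + 1) / M ^ r\<close>; this choice of \<open>q\<close>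
    makes it exceed one.\<close>
  define M where "M = Suc (N * m)"
  define r where "r = N - 1"
  define q where "q = M ^ r"
  define d where "d = q * N"
  have Nr: "N = Suc r" using steps by (simp add: N_def r_def)
  have K: "Suc (d * m) \<le> Suc q * M"
    by (simp add: d_def M_def algebra_simps)
  have not1: "\<not> invariants d xs \<subseteq> fs.span B" if B: "finite B" "card B \<le> 1" for B
  proof
    assume "invariants d xs \<subseteq> fs.span B"
    from invariants_bound[OF chain B(1) this] obtain C where C: "finite C"
      "card C \<le> Suc (d * m) ^ effective_steps xs * card B"
      "{f :: complex^'n \<Rightarrow> complex. is_hpoly d f} \<subseteq> fs.span C"
      by blast
    have "Suc q ^ N \<le> card C"
      using homogeneous_dimension_lower_bound[OF C(1), of q] C(3) by (simp add: N_def d_def)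
    also have "card C \<le> Suc (d * m) ^ effective_steps xs * 1"
      by (rule order_trans[OF C(2)]) (use B(2) in \<open>auto intro!: mult_left_mono\<close>)
    also have "\<dots> \<le> Suc (d * m) ^ r"
      using steps by (auto simp: r_def N_def intro!: power_increasing)
    also have "\<dots> \<le> (Suc q * M) ^ r"
      using K by (rule power_mono) simp
    also have "\<dots> = Suc q ^ r * q" by (simp only: power_mult_distrib q_def)
    also have "\<dots> < Suc q ^ N" by (simp add: Nr)
    finally show False by simp
  qed
  obtain Q where Q: "Q \<in> invariants d xs" "Q \<notin> fs.span {}" using not1[of "{}"] by auto
  obtain P where P: "P \<in> invariants d xs" "P \<notin> fs.span {Q}" using not1[of "{Q}"] by auto
  have "P \<noteq> (\<lambda>z. c * Q z)" for c
    using P(2) fs.span_scale[OF fs.span_base[of Q "{Q}"], of c] by auto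
  then show ?thesis using that P Q by (auto simp: zero_fun_def)
qed

section \<open>The foliation\<close>

text \<open>Tangency conditions are polynomial, so a generic condition extends to every point.\<close>
lemma generically_zero:
  assumes "is_poly F" "generically (\<lambda>z. F z = 0)" shows "F z = 0"
proof (rule ccontr)
  assume F: "F z \<noteq> 0"
  obtain Z where Z: "algebraic_set Z" "Z \<noteq> UNIV" "\<And>z. z \<notin> Z \<Longrightarrow> F z = 0"
    using assms(2) by (auto simp: generically_def)
  from Z(1) obtain S where S: "\<And>p. p \<in> S \<Longrightarrow> poly_fun p" "Z = {z. \<forall>p\<in>S. p z = 0}"
    by (auto simp: algebraic_set_def)
  with Z(2) obtain p b where p: "p \<in> S" "p b \<noteq> 0" by auto
  from is_poly_common_nonzero[OF assms(1) poly_fun_is_poly[OF S(1)[OF p(1)]] F p(2)]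
  show False using Z(3) S(2) p(1) by blast
qed

lemma irreducible_UNIV: "irreducible_algebraic_set (UNIV :: (complex^'n) set)"
proof -
  have nz: "\<exists>p b. is_poly p \<and> p b \<noteq> 0 \<and> (\<forall>z\<in>Z. p z = 0)"
    if "algebraic_set Z" "Z \<noteq> UNIV" for Z :: "(complex^'n) set"
  proof -
    obtain S where S: "\<And>p. p \<in> S \<Longrightarrow> poly_fun p" "Z = {z. \<forall>p\<in>S. p z = 0}"
      using \<open>algebraic_set Z\<close> by (auto simp: algebraic_set_def)
    with \<open>Z \<noteq> UNIV\<close> obtain p b where "p \<in> S" "p b \<noteq> 0" by auto
    then show ?thesis using S poly_fun_is_poly[OF S(1), of p]
      by (intro exI[of _ p] exI[of _ b]) simp
  qed
  have "algebraic_set (UNIV :: (complex^'n) set)"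
    unfolding algebraic_set_def by (rule exI[of _ "{}"]) simp
  moreover have "Y1 = UNIV \<or> Y2 = UNIV"
    if Y: "algebraic_set Y1" "algebraic_set Y2" "Y1 \<union> Y2 = UNIV" for Y1 Y2 :: "(complex^'n) set"
  proof (rule ccontr)
    assume "\<not> ?thesis"
    then have "Y1 \<noteq> UNIV" "Y2 \<noteq> UNIV" by auto
    then obtain p q a b where pq: "is_poly p" "is_poly q" "p a \<noteq> 0" "q b \<noteq> 0"
      "\<forall>z\<in>Y1. p z = 0" "\<forall>z\<in>Y2. q z = 0"
      using nz[OF Y(1)] nz[OF Y(2)] by auto
    from is_poly_common_nonzero[OF pq(1-4)] show False using pq(5,6) Y(3) by blast
  qed
  ultimately show ?thesis unfolding irreducible_algebraic_set_def by auto
qed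

text \<open>
  If \<open>A\<close> vanished identically, its zero set would be the whole space. As the latter is irreducible,
  it would have codimension zero.
\<close>
lemma codim1_foliation_nonzero:
  assumes "codim1_foliation A" shows "\<exists>z. A z \<noteq> 0"
proof (rule ccontr)
  assume "\<not> ?thesis"
  then have "{z. \<forall>k. A z $ k = 0} = UNIV" by auto
  then have "2 \<le> alg_codim (UNIV :: (complex^'a) set)"
    using assms by (simp add: codim1_foliation_def)
  also have "\<dots> \<le> irreducible_codim (UNIV :: (complex^'a) set)"
    unfolding alg_codim_def by (rule INF_lower) (simp add: irreducible_UNIV)
  also have "\<dots> \<le> 0"
    unfolding irreducible_codim_def
  proof (rule Sup_least, clarify)
    fix k and C :: "nat \<Rightarrow> (complex^'a) set"
    assume "C 0 = UNIV" "\<forall>i<k. C i \<subset> C (Suc i)"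
    then show "enat k \<le> 0" by (cases k) (auto simp: zero_enat_def)
  qed
  finally show False by simp
qed

lemma mpow_eq_0_mono: "mpow x k = 0 \<Longrightarrow> k \<le> m \<Longrightarrow> mpow x m = 0"
proof (induction m)
  case (Suc m)
  then show ?case by (cases "k = Suc m") (auto simp: mpow_Suc(1))
qed simp

lemma common_nilpotency_order:
  assumes "\<And>x. x \<in> set xs \<Longrightarrow> nilpotent_matrix x"
  obtains m where "\<And>x. x \<in> set xs \<Longrightarrow> mpow x m = 0"
proof -
  have "\<exists>m. \<forall>x\<in>set xs. mpow x m = 0"
    using assms
  proof (induction xs)
    case (Cons x xs)
    obtain m where "\<forall>x\<in>set xs. mpow x m = 0" using Cons by auto
    moreover obtain k where "mpow x k = 0"
      using Cons.prems[of x] by (auto simp: nilpotent_matrix_def mpow_def)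
    ultimately show ?case
      by (intro exI[of _ "max m k"]) (auto intro: mpow_eq_0_mono[of _ _ "max m k"])
  qed simp
  then show ?thesis using that by blast
qed

lemma trace_mat: "trace (mat c :: complex^'n^'n) = of_nat CARD('n) * c"
  by (simp add: trace_def mat_def)

text \<open>The trace singles out the nilpotent one among the matrices inducing a nilpotent field.\<close>
lemma nilpotent_field_traceless:
  fixes B :: "complex^'n^'n"
  assumes "nilpotent_field (cp_field_of_matrix B)" "trace B = 0"
  shows "nilpotent_matrix B"
proof -
  obtain B' where B': "cp_field_of_matrix B = cp_field_of_matrix B'" "nilpotent_matrix B'"
    using assms(1) unfolding nilpotent_field_def by blast
  then obtain c where c: "B - B' = mat c" by (auto simp: cp_field.abs_eq_iff)
  have "of_nat CARD('n) * c = 0"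
    using arg_cong[OF c, of trace] assms(2) nilpotent_matrix_trace[OF B'(2)]
    by (simp add: trace_sub trace_mat)
  then have "B = B'" using c by (simp add: mat_def vec_eq_iff)
  then show ?thesis using B' by simp
qed

theorem mainTheorem11:
  fixes A :: "complex^'n \<Rightarrow> complex^'n"
  assumes "L_foliation A"
    and "\<forall>X\<in>tangent_algebra A. nilpotent_field X"
  shows "\<exists>P Q. nonconst_rational_first_integral A P Q"
proof -
  have fol: "codim1_foliation A" using assms(1) by (simp add: L_foliation_def)
  obtain L where L: "lie_subalgebra L"
    and gen: "generically (\<lambda>z. (\<Union>X\<in>L. field_at X z) = leaf_tangent A z)"
    using assms(1) by (auto simp: L_foliation_def)
  have pfA: "is_poly (\<lambda>z. A z $ k)" for k
    using fol unfolding codim1_foliation_def by (meson is_hpoly_is_poly homogeneous_poly_is_hpoly)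
  have rad: "eval_form (A z) z = 0" for z
    using fol unfolding codim1_foliation_def eval_form_def by (simp add: mult.commute)
  obtain a where a: "A a \<noteq> 0" using codim1_foliation_nonzero[OF fol] by blast
  have tan: "eval_form (A z) (B *v z) = 0" if "cp_field_of_matrix B \<in> L" for B z
  proof (rule generically_zero[of "\<lambda>z. eval_form (A z) (B *v z)"])
    show "is_poly (\<lambda>z. eval_form (A z) (B *v z))"
      unfolding eval_form_def matrix_vector_mult_def
      by (auto intro!: is_poly_sum is_poly_mult pfA is_poly_const is_poly_coord)
    have "B *v z \<in> (\<Union>X\<in>L. field_at X z)" for z using that by (auto simp: field_at_def)
    then show "generically (\<lambda>z. eval_form (A z) (B *v z) = 0)"
      using gen unfolding generically_def leaf_tangent_def by blast
  qed
  have LT: "L \<subseteq> tangent_algebra A"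
    using tan by (auto simp: tangent_algebra_def field_at_def leaf_tangent_def)
  \<comment> \<open>Normalizing by the trace lifts the algebra of fields to an algebra of matrices: commutators
    are traceless, and sums of traceless matrices are traceless.\<close>
  define H where "H = {B :: complex^'n^'n. trace B = 0 \<and> cp_field_of_matrix B \<in> L}"
  have scale: "c *\<^sub>R B = (\<chi> i j. of_real c * B $ i $ j)" for c and B :: "complex^'n^'n"
    by (simp add: vec_eq_iff scaleR_conv_of_real[where 'a = complex])
  have H: "subspace H"
  proof (rule subspaceI)
    show "0 \<in> H" using L by (simp add: H_def trace_def lie_subalgebra_def cp_zero.abs_eq)
    show "x + y \<in> H" if "x \<in> H" "y \<in> H" for x y
      using that L by (auto simp: H_def trace_add lie_subalgebra_def simp flip: cp_add.abs_eq)
    show "c *\<^sub>R x \<in> H" if "x \<in> H" for c x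
    proof -
      have "cp_field_of_matrix (c *\<^sub>R x) = cp_scale (of_real c) (cp_field_of_matrix x)"
        by (simp add: scale cp_scale.abs_eq)
      moreover have "trace (c *\<^sub>R x) = of_real c * trace x"
        by (simp add: scale trace_def sum_distrib_left)
      ultimately show ?thesis using that L by (simp add: H_def lie_subalgebra_def)
    qed
  qed
  have Hc: "comm x y \<in> H" if "x \<in> H" "y \<in> H" for x y
    using that L
    by (auto simp: H_def comm_def trace_sub trace_mul_sym[of x y] lie_subalgebra_def
        simp flip: cp_bracket.abs_eq)
  have Hn: "nilpotent_matrix x" if "x \<in> H" for x
    using that LT assms(2) by (auto simp: H_def intro: nilpotent_field_traceless)
  obtain xs where xs: "subnormal_chain xs" "span (set xs) = H"
    using subnormal_chain_exists[OF H Hc Hn] by blast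
  have xsH: "x \<in> H" if "x \<in> set xs" for x using that xs(2) span_base by blast
  obtain m where m: "\<And>x. x \<in> set xs \<Longrightarrow> mpow x m = 0"
    using common_nilpotency_order[of xs] Hn xsH by blast
  obtain l b where l: "l \<in> invariants 1 xs" "l b \<noteq> 0"
    using linear_invariant_exists[OF xs(1) m] by blast
  have steps: "effective_steps xs + 2 \<le> CARD('n)"
    by (rule effective_steps_bound[OF pfA a rad _ l]) (use xsH tan in \<open>auto simp: H_def\<close>)
  obtain d P Q
    where P: "P \<in> invariants d xs" and Q: "Q \<in> invariants d xs" and Q0: "Q \<noteq> (\<lambda>z. 0)"
      and PQ: "\<nexists>c. P = (\<lambda>z. c * Q z)"
    by (rule two_invariants_exist[OF xs(1) _ steps]) (erule m, rule that)
  have hP: "is_hpoly d P" and hQ: "is_hpoly d Q" using P Q by (auto simp: invariants_def)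
  note pfP = is_hpoly_is_poly[OF hP] and pfQ = is_hpoly_is_poly[OF hQ]
  obtain z0 where z0: "Q z0 \<noteq> 0" using Q0 by (auto simp: fun_eq_iff)
  \<comment> \<open>The numerator of \<open>d(P / Q)\<close>, which has polynomial coefficients.\<close>
  define \<eta> where "\<eta> z = Q z *s differential P z - P z *s differential Q z" for z
  have killed: "eval_form (\<eta> z) (B *v z) = 0" if B: "cp_field_of_matrix B \<in> L" for B z
  proof -
    define c where "c = trace B / of_nat CARD('n)"
    have "cp_field_of_matrix (B - mat c) = cp_field_of_matrix B"
      unfolding cp_field.abs_eq_iff by (rule exI[of _ "- c"]) (simp add: mat_def vec_eq_iff)
    then have span: "B - mat c \<in> span (set xs)"
      using B by (simp add: xs(2) H_def trace_sub trace_mat c_def)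
    have "lie_deriv (B - mat c) f = (\<lambda>z. 0)" if "f \<in> invariants d xs" for f
      by (rule lie_deriv_span_zero[OF _ span]) (use that in \<open>auto simp: invariants_def\<close>)
    then have "lie_deriv (B - mat c) P z = 0" "lie_deriv (B - mat c) Q z = 0" using P Q by auto
    moreover have "(B - mat c) *v z = B *v z - c *s z"
      by (simp add: matrix_vector_mult_diff_rdistrib)
         (simp add: matrix_vector_mult_def mat_def vec_eq_iff if_distrib if_distribR cong: if_cong)
    ultimately have "eval_form (differential P z) (B *v z) = c * (of_nat d * P z)"
      "eval_form (differential Q z) (B *v z) = c * (of_nat d * Q z)"
      using euler_identity[OF hP, of z] euler_identity[OF hQ, of z]
      by (auto simp: lie_deriv_def eval_form_linear)
    then show ?thesis by (simp add: \<eta>_def eval_form_linear)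
  qed
  have wedge: "\<eta> z $ i * A z $ j - \<eta> z $ j * A z $ i = 0" for z i j
  proof (rule generically_zero[of "\<lambda>z. \<eta> z $ i * A z $ j - \<eta> z $ j * A z $ i"])
    show "is_poly (\<lambda>z. \<eta> z $ i * A z $ j - \<eta> z $ j * A z $ i)"
      by (auto simp: \<eta>_def intro!: is_poly_diff is_poly_mult pfA pfP pfQ is_poly_differential)
    have "\<eta> z $ i * A z $ j - \<eta> z $ j * A z $ i = 0"
      if "(\<Union>X\<in>L. field_at X z) = leaf_tangent A z" for z
    proof -
      \<comment> \<open>On this vector of the kernel of \<open>A z\<close>, the form \<open>\<eta>\<close> takes the value of the wedge
        product.\<close>
      define v where "v = A z $ j *s axis i 1 - A z $ i *s axis j (1::complex)"
      have "v \<in> leaf_tangent A z"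
        by (simp add: v_def leaf_tangent_def eval_form_linear eval_form_axis)
      with that obtain B where "cp_field_of_matrix B \<in> L" "v = B *v z"
        by (auto simp: field_at_def)
      then have "eval_form (\<eta> z) v = 0" using killed by simp
      then show ?thesis by (simp add: v_def eval_form_linear eval_form_axis mult.commute)
    qed
    then show "generically (\<lambda>z. \<eta> z $ i * A z $ j - \<eta> z $ j * A z $ i = 0)"
      using gen unfolding generically_def by blast
  qed
  have "nonconst_rational_first_integral A P Q"
    unfolding nonconst_rational_first_integral_def
  proof (intro conjI allI impI)
    show "\<exists>d. homogeneous_poly d P \<and> homogeneous_poly d Q"
      using hP hQ is_hpoly_homogeneous_poly by blast
    show "\<exists>z. Q z \<noteq> 0" using z0 by blast
    show "\<nexists>c. \<forall>z. Q z \<noteq> 0 \<longrightarrow> P z / Q z = c"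
    proof
      assume "\<exists>c. \<forall>z. Q z \<noteq> 0 \<longrightarrow> P z / Q z = c"
      then obtain c where c: "\<And>z. Q z \<noteq> 0 \<Longrightarrow> P z = c * Q z" by (auto simp: field_simps)
      have "P z - c * Q z = 0" for z
        using is_poly_common_nonzero[OF is_poly_diff[OF pfP is_poly_mult[OF is_poly_const pfQ]] pfQ _ z0, of z c] c
        by auto
      then show False using PQ by (auto simp: fun_eq_iff)
    qed
    show "wedge11 (differential (\<lambda>w. P w / Q w) z) (A z) i j = 0" if "Q z \<noteq> 0" for z i j
    proof -
      have "wedge11 (differential (\<lambda>w. P w / Q w) z) (A z) i j
          = 1 / (Q z)\<^sup>2 * (\<eta> z $ i * A z $ j - \<eta> z $ j * A z $ i)"
        unfolding wedge11_def differential_divide[OF pfP pfQ that] \<eta>_def[symmetric]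
        by (simp add: algebra_simps)
      then show ?thesis by (simp add: wedge)
    qed
  qed
  then show ?thesis by blast
qed

end
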